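(* Let $d\ge1$ and $r\ge3$ be integers and let $G=G_{r,d}$. Then (1) $a(\mathbb{K}[E(G)]/I_G)=1-d-r$, and (2) $e(\mathbb{K}[E(G)]/I_G)=dr-(d-1)$.
   Context: $\mathbb{K}$ is an algebraically closed field of characteristic $0$. For integers $d\ge1$, $r\ge3$, the graph $G_{r,d}$ has vertex set $\{x_1,x_2,y_1,\ldots,y_d,z_1,\ldots,z_{2r-3}\}$ and edge set $$\{\{x_i,y_j\}: 1\le i\le2,\ 1\le j\le d\}\cup\{\{x_1,z_1\},\{z_1,z_2\},\{z_2,z_3\},\ldots,\{z_{2r-4},z_{2r-3}\},\{z_{2r-3},x_2\}\},$$ i.e. a complete bipartite graph $K_{2,d}$ together with a path of length $2r-2$ joining $x_1$ and $x_2$. For a finite simple graph $G$ with vertex set $V$ and edge set $E(G)$ (vertices and edges also naming variables of degree $1$), the toric ideal $I_G\subseteq\mathbb{K}[E(G)]$ is the kernel of the $\mathbb{K}$-algebra homomorphism $\mathbb{K}[E(G)]\to\mathbb{K}[V]$ sending each edge $e=\{u,w\}$ to $uw$. For a finitely generated graded module $M$ of dimension $\delta$ with Hilbert series $h_M(t)/(1-t)^{\delta}$: $a(M)=\deg h_M(t)-\delta$ ($a$-invariant) and $e(M)=h_M(1)$ (multiplicity). *)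

theory Defs
  imports
    "HOL-Library.Poly_Mapping"
    "HOL-Library.Extended_Nat"
    "HOL-Algebra.QuotRing"
    "HOL-Algebra.Embedded_Algebras"
    "HOL-Computational_Algebra.Polynomial_FPS"
begin

section \<open>Polynomial rings in an arbitrary set of variables\<close>

text \<open>
  A monomial is a finitely supported exponent vector, and a polynomial is a finitely supported
  family of coefficients indexed by monomials; the multiplication of \<^typ>\<open>('v \<Rightarrow>\<^sub>0 nat) \<Rightarrow>\<^sub>0 'k\<close>
  is the convolution product.
\<close>

type_synonym ('v, 'k) mpoly = "('v \<Rightarrow>\<^sub>0 nat) \<Rightarrow>\<^sub>0 'k"

definition Const :: "'k \<Rightarrow> ('v, 'k::field) mpoly"
  where "Const c = Poly_Mapping.single 0 c"

definition Var :: "'v \<Rightarrow> ('v, 'k::field) mpoly"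
  where "Var v = Poly_Mapping.single (Poly_Mapping.single v 1) 1"

definition mpoly_ring :: "'v set \<Rightarrow> ('v, 'k::field) mpoly ring"
  where "mpoly_ring S =
    \<lparr>carrier = {p. \<forall>m \<in> Poly_Mapping.keys p. Poly_Mapping.keys m \<subseteq> S},
     monoid.mult = (*), one = 1, zero = 0, add = (+)\<rparr>"

definition monomial_degree :: "('v \<Rightarrow>\<^sub>0 nat) \<Rightarrow> nat"
  where "monomial_degree m = (\<Sum>v \<in> Poly_Mapping.keys m. Poly_Mapping.lookup m v)"

definition homogeneous_part :: "'v set \<Rightarrow> nat \<Rightarrow> ('v, 'k::field) mpoly set"
  where "homogeneous_part S n =
    {p \<in> carrier (mpoly_ring S). \<forall>m \<in> Poly_Mapping.keys p. monomial_degree m = n}"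

text \<open>The value of the \<^typ>\<open>'k\<close>-algebra homomorphism that sends each variable \<open>v\<close> to \<open>f v\<close>.\<close>

definition mpoly_subst :: "('v \<Rightarrow> ('w, 'k) mpoly) \<Rightarrow> ('v, 'k::field) mpoly \<Rightarrow> ('w, 'k) mpoly"
  where "mpoly_subst f p =
    (\<Sum>m \<in> Poly_Mapping.keys p.
      Const (Poly_Mapping.lookup p m) *
      (\<Prod>v \<in> Poly_Mapping.keys m. f v ^ Poly_Mapping.lookup m v))"


section \<open>Graded algebras and their invariants\<close>

text \<open>
  A graded algebra carries the (image of the) base field \<open>scalars\<close>, as a subfield, and
  its homogeneous components \<open>component n\<close> for \<open>n \<ge> 0\<close>.
\<close>

record 'a graded_algebra = "'a ring" +
  scalars :: "'a set"
  component :: "nat \<Rightarrow> 'a set"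

text \<open>The Krull dimension: the supremum of the lengths of strict chains of prime ideals.\<close>

definition krull_dim :: "('a, 'm) ring_scheme \<Rightarrow> enat"
  where "krull_dim A =
    Sup {enat n | n. \<exists>P. (\<forall>i\<le>n. primeideal (P i) A) \<and> (\<forall>i<n. P i \<subset> P (Suc i))}"

definition hilbert_function :: "('a, 'm) graded_algebra_scheme \<Rightarrow> nat \<Rightarrow> nat"
  where "hilbert_function A n = ring.dim A (scalars A) (component A n)"

definition hilbert_series :: "('a, 'm) graded_algebra_scheme \<Rightarrow> int fps"
  where "hilbert_series A = Abs_fps (\<lambda>n. int (hilbert_function A n))"

text \<open>
  The numerator \<open>h(t)\<close> in \<open>hilbert_series = h(t) / (1 - t) ^ \<delta>\<close>, where \<open>\<delta>\<close> is the Krull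
  dimension. There is at most one such polynomial since \<open>(1 - t) ^ \<delta>\<close> is invertible as a
  power series.
\<close>

definition h_polynomial :: "('a, 'm) graded_algebra_scheme \<Rightarrow> int poly"
  where "h_polynomial A = (THE h. \<exists>\<delta>. krull_dim A = enat \<delta> \<and>
    fps_of_poly h = hilbert_series A * (1 - fps_X) ^ \<delta>)"

definition a_invariant :: "('a, 'm) graded_algebra_scheme \<Rightarrow> int"
  where "a_invariant A = int (Polynomial.degree (h_polynomial A)) - int (the_enat (krull_dim A))"

definition multiplicity_e :: "('a, 'm) graded_algebra_scheme \<Rightarrow> int"
  where "multiplicity_e A = poly (h_polynomial A) 1"


section \<open>Toric ideals of graphs\<close>

text \<open>
  A graph is given by its vertex set \<open>V\<close> and its set \<open>E\<close> of edges, which are two-element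
  subsets of \<open>V\<close>. The edges themselves serve as the variables of the polynomial ring \<open>K[E]\<close>.
\<close>

definition toric_map :: "('v set, 'k::field) mpoly \<Rightarrow> ('v, 'k) mpoly"
  where "toric_map = mpoly_subst (\<lambda>e. \<Prod>v \<in> e. Var v)"

definition toric_ideal :: "'v set \<Rightarrow> 'v set set \<Rightarrow> ('v set, 'k::field) mpoly set"
  where "toric_ideal V E = a_kernel (mpoly_ring E) (mpoly_ring V) toric_map"

text \<open>The standard graded algebra \<open>K[E] / I\<close>, where \<open>I\<close> is the toric ideal.\<close>

definition toric_ring :: "'v set \<Rightarrow> 'v set set \<Rightarrow> ('v set, 'k::field) mpoly set graded_algebra"
  where "toric_ring V E =
    (let R = mpoly_ring E; I = toric_ideal V E
     in ring.extend (R Quot I)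
          (graded_algebra.fields
            (range (\<lambda>c. I +>\<^bsub>R\<^esub> Const c))
            (\<lambda>n. (\<lambda>p. I +>\<^bsub>R\<^esub> p) ` homogeneous_part E n)))"


section \<open>The graphs \<open>G r d\<close>\<close>

datatype vertex = X nat | Y nat | Z nat

definition G_vertices :: "nat \<Rightarrow> nat \<Rightarrow> vertex set"
  where "G_vertices r d = X ` {1..2} \<union> Y ` {1..d} \<union> Z ` {1..2 * r - 3}"

definition G_edges :: "nat \<Rightarrow> nat \<Rightarrow> vertex set set"
  where "G_edges r d =
    {{X i, Y j} | i j. 1 \<le> i \<and> i \<le> 2 \<and> 1 \<le> j \<and> j \<le> d} \<union>
    {{X 1, Z 1}} \<union>
    {{Z i, Z (i + 1)} | i. 1 \<le> i \<and> i \<le> 2 * r - 4} \<union>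
    {{Z (2 * r - 3), X 2}}"

end

theory Submission
  imports Defs
begin

text \<open>
  The toric ring is isomorphic to the span, inside \<open>K[V]\<close>, of the monomials given by the vertex
  degree vectors of multisets of edges, so its Hilbert function counts such vectors. Put
  \<open>k = r - 1\<close>. Modulo the binomial of the even cycle through the path and those of the
  4-cycles, a vector is determined by the degrees at the \<open>Y j\<close>, by the total weight \<open>t\<close>
  of the edges between \<open>X 2\<close> and the \<open>Y j\<close>, and by the weights on the path, subject to
  \<open>t = 0\<close> or one of the odd path edges having weight \<open>0\<close>. The generating function is
  \[ \frac{1}{(1-x)^{d+2k}} + \frac{d x (1 - x^k)}{(1-x)^{d+2k+1}}
     = \frac{1 + d (x + \dots + x^k)}{(1-x)^{d+2k}}. \]

  The Krull dimension is \<open>d + 2k\<close>, one less than the number of vertices. For the upper bound,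
  choosing \<open>x i \<in> P (i + 1) - P i\<close> in a chain of \<open>m\<close> strict prime inclusions gives
  \<open>m\<close> algebraically independent elements. The \<open>(N + 1)^m\<close> monomials in them with
  exponents at most \<open>N\<close> lie in the span of the monomials of degree \<open>O(N)\<close>, of which there
  are only \<open>O(N^(d + 2k))\<close>, because the graph is bipartite and so the degree at \<open>X 2\<close> is
  determined by the others. For the lower bound, delete the vertices one at a time in such an order
  that each deletion destroys an edge, and take the kernels of the maps that set the deleted
  variables to \<open>0\<close>.
\<close>

section \<open>Polynomial rings\<close>

lemma Const_0 [simp]: "Const 0 = 0"
  and Const_1 [simp]: "Const 1 = 1"
  and Const_add: "Const (a + b) = Const a + Const b"
  and Const_mult: "Const (a * b) = Const a * Const b"
  and Const_uminus: "Const (- a) = - Const a"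
  by (simp_all add: Const_def single_add mult_single single_uminus)

lemma Const_times_single: "Const c * Poly_Mapping.single m a = Poly_Mapping.single m (c * a)"
  by (simp add: Const_def mult_single)

lemma poly_mapping_sum_single:
  assumes "finite S" "Poly_Mapping.keys p \<subseteq> S"
  shows "p = (\<Sum>m\<in>S. Poly_Mapping.single m (Poly_Mapping.lookup p m))"
proof (rule poly_mapping_eqI)
  fix k
  have "Poly_Mapping.lookup (\<Sum>m\<in>S. Poly_Mapping.single m (Poly_Mapping.lookup p m)) k
    = (\<Sum>m\<in>S. if m = k then Poly_Mapping.lookup p m else 0)"
    unfolding lookup_sum by (intro sum.cong) (auto simp: lookup_single)
  also have "\<dots> = Poly_Mapping.lookup p k"
    using assms by (auto simp: in_keys_iff)
  finally show "Poly_Mapping.lookup p k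
    = Poly_Mapping.lookup (\<Sum>m\<in>S. Poly_Mapping.single m (Poly_Mapping.lookup p m)) k" by simp
qed

text \<open>This is the inner product of \<open>mpoly_subst\<close>, named so that its
  multiplicativity \<open>eval_monom_add\<close> can be settled before that of substitution.\<close>

definition eval_monom :: "('v \<Rightarrow> 'a::comm_monoid_mult) \<Rightarrow> ('v \<Rightarrow>\<^sub>0 nat) \<Rightarrow> 'a"
  where "eval_monom f m = (\<Prod>v\<in>Poly_Mapping.keys m. f v ^ Poly_Mapping.lookup m v)"

lemma eval_monom_superset:
  assumes "finite S" "Poly_Mapping.keys m \<subseteq> S"
  shows "eval_monom f m = (\<Prod>v\<in>S. f v ^ Poly_Mapping.lookup m v)"
  unfolding eval_monom_def using assms
  by (intro prod.mono_neutral_left) (auto simp: in_keys_iff)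

lemma eval_monom_add: "eval_monom f (m + n) = eval_monom f m * eval_monom f n"
proof -
  define S where "S = Poly_Mapping.keys m \<union> Poly_Mapping.keys n"
  have S: "finite S" "Poly_Mapping.keys m \<subseteq> S" "Poly_Mapping.keys n \<subseteq> S" "Poly_Mapping.keys (m + n) \<subseteq> S"
    using keys_add[of m n] by (auto simp: S_def)
  show ?thesis
    using S by (simp add: eval_monom_superset[of S] lookup_add power_add prod.distrib)
qed

lemma eval_monom_0 [simp]: "eval_monom f 0 = 1"
  by (simp add: eval_monom_def)

lemma eval_monom_single: "eval_monom f (Poly_Mapping.single v n) = f v ^ n"
  by (cases "n = 0") (simp_all add: eval_monom_def)

lemma Var_power: "Var v ^ n = Poly_Mapping.single (Poly_Mapping.single v n) 1"
  by (induction n) (simp_all add: Var_def mult_single flip: single_add)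

lemma prod_single_1:
  "(\<Prod>i\<in>S. Poly_Mapping.single (g i) 1) = Poly_Mapping.single (sum g S) (1 :: 'k::field)"
  by (induction S rule: infinite_finite_induct) (simp_all add: mult_single)

lemma eval_monom_Var: "eval_monom Var m = Poly_Mapping.single m 1"
  unfolding eval_monom_def Var_power prod_single_1
  using poly_mapping_sum_single[of "Poly_Mapping.keys m" m] by simp

section \<open>Substitution as an algebra homomorphism\<close>

lemma mpoly_subst_superset:
  assumes "finite S" "Poly_Mapping.keys p \<subseteq> S"
  shows "mpoly_subst f p = (\<Sum>m\<in>S. Const (Poly_Mapping.lookup p m) * eval_monom f m)"
  unfolding mpoly_subst_def eval_monom_def[symmetric] using assms
  by (intro sum.mono_neutral_left) (auto simp: in_keys_iff)

lemma mpoly_subst_single: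
  "mpoly_subst f (Poly_Mapping.single m c) = Const c * eval_monom f m"
  by (subst mpoly_subst_superset[of "{m}"]) auto

lemma mpoly_subst_0 [simp]: "mpoly_subst f 0 = 0"
  by (simp add: mpoly_subst_def)

lemma mpoly_subst_1 [simp]: "mpoly_subst f 1 = 1"
  using mpoly_subst_single[of f 0 1] by simp

lemma mpoly_subst_Const [simp]: "mpoly_subst f (Const c) = Const c"
  using mpoly_subst_single[of f 0 c] by (simp add: Const_def)

lemma mpoly_subst_Var [simp]: "mpoly_subst f (Var v) = f v"
  unfolding Var_def by (simp add: mpoly_subst_single eval_monom_single)

lemma mpoly_subst_add: "mpoly_subst f (p + q) = mpoly_subst f p + mpoly_subst f q"
proof -
  define S where "S = Poly_Mapping.keys p \<union> Poly_Mapping.keys q"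
  have S: "finite S" "Poly_Mapping.keys p \<subseteq> S" "Poly_Mapping.keys q \<subseteq> S" "Poly_Mapping.keys (p + q) \<subseteq> S"
    using keys_add[of p q] by (auto simp: S_def)
  show ?thesis
    using S by (simp add: mpoly_subst_superset[of S] lookup_add Const_add algebra_simps sum.distrib)
qed

lemma mpoly_subst_sum: "mpoly_subst f (sum g S) = (\<Sum>i\<in>S. mpoly_subst f (g i))"
  by (induction S rule: infinite_finite_induct) (simp_all add: mpoly_subst_add)

text \<open>Both factors are expanded into single terms, so that bilinearity reduces the claim to
  \<open>eval_monom_add\<close>.\<close>

lemma mpoly_subst_mult: "mpoly_subst f (p * q) = mpoly_subst f p * mpoly_subst f q"
proof -
  let ?s = "\<lambda>p m. Poly_Mapping.single m (Poly_Mapping.lookup p m)"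
  have p: "p = sum (?s p) (Poly_Mapping.keys p)" and q: "q = sum (?s q) (Poly_Mapping.keys q)"
    by (auto intro: poly_mapping_sum_single)
  have "p * q = (\<Sum>m\<in>Poly_Mapping.keys p. \<Sum>n\<in>Poly_Mapping.keys q. ?s p m * ?s q n)"
    by (subst p, subst q, rule sum_product)
  then have "mpoly_subst f (p * q) = (\<Sum>m\<in>Poly_Mapping.keys p. \<Sum>n\<in>Poly_Mapping.keys q.
      mpoly_subst f (?s p m) * mpoly_subst f (?s q n))"
    by (simp add: mpoly_subst_sum mult_single mpoly_subst_single eval_monom_add Const_mult mult_ac)
  also have "\<dots> = mpoly_subst f (sum (?s p) (Poly_Mapping.keys p)) * mpoly_subst f (sum (?s q) (Poly_Mapping.keys q))"
    by (simp add: mpoly_subst_sum sum_product)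
  finally show ?thesis using p q by simp
qed

section \<open>The polynomial ring on the variables in \<open>S\<close>\<close>

lemma mpoly_ring_simps [simp]:
  "carrier (mpoly_ring S) = {p. \<forall>m\<in>Poly_Mapping.keys p. Poly_Mapping.keys m \<subseteq> S}"
  "monoid.mult (mpoly_ring S) = (*)" "one (mpoly_ring S) = 1"
  "zero (mpoly_ring S) = 0" "add (mpoly_ring S) = (+)"
  by (simp_all add: mpoly_ring_def)

lemma mpoly_ring_add_closed:
  "p \<in> carrier (mpoly_ring S) \<Longrightarrow> q \<in> carrier (mpoly_ring S) \<Longrightarrow> p + q \<in> carrier (mpoly_ring S)"
  using keys_add[of p q] by auto

lemma mpoly_ring_mult_closed:
  assumes "p \<in> carrier (mpoly_ring S)" "q \<in> carrier (mpoly_ring S)"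
  shows "p * q \<in> carrier (mpoly_ring S)"
proof -
  have "Poly_Mapping.keys m \<subseteq> S" if m: "m \<in> Poly_Mapping.keys (p * q)" for m
  proof -
    obtain a b where "m = a + b" "a \<in> Poly_Mapping.keys p" "b \<in> Poly_Mapping.keys q"
      using keys_mult[of p q] m by auto
    moreover have "Poly_Mapping.keys a \<subseteq> S" "Poly_Mapping.keys b \<subseteq> S"
      using assms calculation by auto
    ultimately show ?thesis using keys_add[of a b] by blast
  qed
  then show ?thesis by auto
qed

lemma Const_in_mpoly_ring: "Const c \<in> carrier (mpoly_ring S)"
  by (cases "c = 0") (auto simp: Const_def)

lemma mpoly_ring_sum_closed:
  "(\<And>i. i \<in> F \<Longrightarrow> g i \<in> carrier (mpoly_ring S)) \<Longrightarrow> sum g F \<in> carrier (mpoly_ring S)"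
  by (induction F rule: infinite_finite_induct)
    (auto simp del: mpoly_ring_simps intro: mpoly_ring_add_closed Const_in_mpoly_ring[of 0, unfolded Const_0])

lemma mpoly_ring_prod_closed:
  "(\<And>i. i \<in> F \<Longrightarrow> g i \<in> carrier (mpoly_ring S)) \<Longrightarrow> prod g F \<in> carrier (mpoly_ring S)"
  by (induction F rule: infinite_finite_induct)
    (auto simp del: mpoly_ring_simps intro: mpoly_ring_mult_closed Const_in_mpoly_ring[of 1, unfolded Const_1])

lemma mpoly_ring_power_closed:
  "p \<in> carrier (mpoly_ring S) \<Longrightarrow> p ^ n \<in> carrier (mpoly_ring S)"
  using mpoly_ring_prod_closed[of "{..<n}" "\<lambda>_. p" S] by simp

lemma cring_mpoly_ring: "cring (mpoly_ring S :: ('v, 'k::field) mpoly ring)"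
proof (rule cringI)
  show "abelian_group (mpoly_ring S :: ('v, 'k) mpoly ring)"
  proof (rule abelian_groupI)
    fix p assume "p \<in> carrier (mpoly_ring S :: ('v, 'k) mpoly ring)"
    then show "\<exists>q\<in>carrier (mpoly_ring S). q \<oplus>\<^bsub>mpoly_ring S\<^esub> p = \<zero>\<^bsub>mpoly_ring S\<^esub>"
      by (intro bexI[of _ "- p"]) (auto simp: in_keys_iff)
  next
    fix p q :: "('v, 'k) mpoly"
    assume "p \<in> carrier (mpoly_ring S)" "q \<in> carrier (mpoly_ring S)"
    then show "p \<oplus>\<^bsub>mpoly_ring S\<^esub> q \<in> carrier (mpoly_ring S)"
      unfolding mpoly_ring_simps(5) by (rule mpoly_ring_add_closed)
  qed (auto simp: add_ac)
  show "comm_monoid (mpoly_ring S :: ('v, 'k) mpoly ring)"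
    by (rule comm_monoidI) (auto simp: mult_ac simp del: mpoly_ring_simps(1)
      intro: mpoly_ring_mult_closed Const_in_mpoly_ring[of 1, unfolded Const_1])
qed (auto simp: distrib_right)

lemma mpoly_subst_closed:
  assumes "\<And>v. v \<in> S \<Longrightarrow> f v \<in> carrier (mpoly_ring T)" "p \<in> carrier (mpoly_ring S)"
  shows "mpoly_subst f p \<in> carrier (mpoly_ring T)"
  unfolding mpoly_subst_def using assms
  by (intro mpoly_ring_sum_closed mpoly_ring_mult_closed mpoly_ring_prod_closed mpoly_ring_power_closed
    Const_in_mpoly_ring) auto

lemma ring_hom_mpoly_subst:
  assumes "\<And>v. v \<in> S \<Longrightarrow> f v \<in> carrier (mpoly_ring T)"
  shows "ring_hom_ring (mpoly_ring S) (mpoly_ring T) (mpoly_subst f)"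
proof (rule ring_hom_ringI)
  show "ring (mpoly_ring S)" "ring (mpoly_ring T)"
    using cring_mpoly_ring by (auto intro: cring.axioms)
  show "mpoly_subst f p \<in> carrier (mpoly_ring T)" if "p \<in> carrier (mpoly_ring S)" for p
    using mpoly_subst_closed assms that by blast
qed (simp_all add: mpoly_subst_mult mpoly_subst_add)

text \<open>A linear order on the variables induces one on the monomials, for which leading terms
  multiply; hence a product of nonzero polynomials is nonzero.\<close>

lemma domain_mpoly_ring: "domain (mpoly_ring S :: ('v::linorder, 'k::field) mpoly ring)"
  by (rule domainI[OF cring_mpoly_ring]) auto

lemma subfield_Const: "subfield (range Const) (mpoly_ring S :: ('v, 'k::field) mpoly ring)"
proof -
  interpret cring "mpoly_ring S :: ('v, 'k) mpoly ring" by (rule cring_mpoly_ring)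
  show ?thesis
  proof (rule subfieldI)
    have neg: "\<ominus>\<^bsub>mpoly_ring S\<^esub> (Const c) = Const (- c)" for c :: 'k
      using Const_in_mpoly_ring by (intro add.inv_equality) (simp_all flip: Const_add del: mpoly_ring_simps(1))
    show sub: "subcring (range Const) (mpoly_ring S :: ('v, 'k) mpoly ring)"
      by (rule subcringI[OF subringI]) (auto simp: neg simp flip: Const_add Const_mult
        simp del: mpoly_ring_simps(1) intro: Const_in_mpoly_ring
        intro!: rangeI intro: range_eqI[of _ _ 1])
    show "Units (mpoly_ring S\<lparr>carrier := range Const\<rparr>)
        = range Const - {\<zero>\<^bsub>mpoly_ring S :: ('v, 'k) mpoly ring\<^esub>}"
    proof -
      have "\<exists>b. Const c * Const b = (1 :: ('v, 'k) mpoly)" if "Const c \<noteq> (0 :: ('v, 'k) mpoly)" for c :: 'k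
      proof -
        have "c \<noteq> 0" using that by auto
        then have "Const c * Const (inverse c) = (1 :: ('v, 'k) mpoly)" by (simp flip: Const_mult)
        then show ?thesis ..
      qed
      then show ?thesis by (auto simp: Units_def mult.commute)
    qed
  qed
qed

section \<open>Hilbert functions of toric rings of graphs\<close>

text \<open>Since an edge variable goes to the product of its ends, this is the exponent vector of
  the image of the monomial \<open>b\<close> under \<open>toric_map\<close>; see
  \<open>toric_map_single\<close>.\<close>

definition vertex_degrees :: "('v set \<Rightarrow>\<^sub>0 nat) \<Rightarrow> 'v \<Rightarrow>\<^sub>0 nat"
  where "vertex_degrees b =
    (\<Sum>e\<in>Poly_Mapping.keys b. \<Sum>v\<in>e. Poly_Mapping.single v (Poly_Mapping.lookup b e))"

definition monomials :: "'v set \<Rightarrow> nat \<Rightarrow> ('v \<Rightarrow>\<^sub>0 nat) set"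
  where "monomials S n = {m. Poly_Mapping.keys m \<subseteq> S \<and> monomial_degree m = n}"

lemma monomial_degree_superset:
  assumes "finite S" "Poly_Mapping.keys m \<subseteq> S"
  shows "monomial_degree m = (\<Sum>v\<in>S. Poly_Mapping.lookup m v)"
  unfolding monomial_degree_def using assms
  by (intro sum.mono_neutral_left) (auto simp: in_keys_iff)

lemma monomial_degree_add: "monomial_degree (m + n) = monomial_degree m + monomial_degree n"
proof -
  define S where "S = Poly_Mapping.keys m \<union> Poly_Mapping.keys n"
  have "finite S" "Poly_Mapping.keys m \<subseteq> S" "Poly_Mapping.keys n \<subseteq> S" "Poly_Mapping.keys (m + n) \<subseteq> S"
    using keys_add[of m n] by (auto simp: S_def)
  then show ?thesis
    by (simp add: monomial_degree_superset[of S] lookup_add sum.distrib)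
qed

lemma lookup_le_monomial_degree: "Poly_Mapping.lookup m v \<le> monomial_degree m"
  by (cases "v \<in> Poly_Mapping.keys m") (auto simp: monomial_degree_def in_keys_iff intro: member_le_sum)

text \<open>Every exponent is bounded by the degree, so such a monomial amounts to a function from
  \<open>S\<close> to \<open>{..n}\<close>.\<close>

lemma finite_monomials_degree_le:
  assumes "finite S"
  shows "finite {m. Poly_Mapping.keys m \<subseteq> S \<and> monomial_degree m \<le> n}"
proof (rule finite_imageD)
  let ?f = "\<lambda>m. restrict (Poly_Mapping.lookup m) S"
  let ?M = "{m. Poly_Mapping.keys m \<subseteq> S \<and> monomial_degree m \<le> n}"
  have "?f ` ?M \<subseteq> S \<rightarrow>\<^sub>E {..n}"
    by (auto intro: order_trans[OF lookup_le_monomial_degree])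
  then show "finite (?f ` ?M)"
    by (rule finite_subset) (use assms in \<open>auto intro: finite_PiE\<close>)
  show "inj_on ?f ?M"
  proof (rule inj_onI, rule poly_mapping_eqI)
    fix a b k assume ab: "a \<in> ?M" "b \<in> ?M" "?f a = ?f b"
    show "Poly_Mapping.lookup a k = Poly_Mapping.lookup b k"
    proof (cases "k \<in> S")
      case True
      then show ?thesis using fun_cong[OF ab(3), of k] by simp
    next
      case False
      then have "k \<notin> Poly_Mapping.keys a" "k \<notin> Poly_Mapping.keys b" using ab by auto
      then show ?thesis by (simp add: in_keys_iff)
    qed
  qed
qed

lemma finite_monomials: "finite S \<Longrightarrow> finite (monomials S n)"
  using finite_monomials_degree_le[of S n] by (rule rev_finite_subset) (auto simp: monomials_def)

lemma lookup_vertex_degrees: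
  assumes "finite F" "Poly_Mapping.keys b \<subseteq> F" "\<And>e. e \<in> F \<Longrightarrow> finite e"
  shows "Poly_Mapping.lookup (vertex_degrees b) v = (\<Sum>e\<in>F. if v \<in> e then Poly_Mapping.lookup b e else 0)"
proof -
  have "Poly_Mapping.lookup (vertex_degrees b) v
    = (\<Sum>e\<in>Poly_Mapping.keys b. if v \<in> e then Poly_Mapping.lookup b e else 0)"
    unfolding vertex_degrees_def lookup_sum using assms
    by (intro sum.cong) (auto simp: lookup_single when_def)
  also have "\<dots> = (\<Sum>e\<in>F. if v \<in> e then Poly_Mapping.lookup b e else 0)"
    using assms by (intro sum.mono_neutral_left) (auto simp: in_keys_iff)
  finally show ?thesis .
qed

lemma keys_vertex_degrees: "Poly_Mapping.keys (vertex_degrees b) \<subseteq> \<Union> (Poly_Mapping.keys b)"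
proof -
  have "Poly_Mapping.lookup (vertex_degrees b) v = 0" if "v \<notin> \<Union> (Poly_Mapping.keys b)" for v
    using that unfolding vertex_degrees_def lookup_sum by (auto intro!: sum.neutral simp: lookup_single when_def)
  then show ?thesis by (auto simp: in_keys_iff)
qed

lemma lookup_vertex_degrees_le:
  assumes "\<And>e. e \<in> Poly_Mapping.keys b \<Longrightarrow> finite e"
  shows "Poly_Mapping.lookup (vertex_degrees b) v \<le> monomial_degree b"
proof -
  have "(\<Sum>e\<in>Poly_Mapping.keys b. if v \<in> e then Poly_Mapping.lookup b e else 0) \<le> monomial_degree b"
    unfolding monomial_degree_def by (intro sum_mono) auto
  then show ?thesis
    using lookup_vertex_degrees[OF finite_keys order_refl, of b v] assms by simp
qed

lemma toric_map_single:
  fixes b :: "'v set \<Rightarrow>\<^sub>0 nat"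
  shows "toric_map (Poly_Mapping.single b c) = Poly_Mapping.single (vertex_degrees b) (c :: 'k::field)"
proof -
  have "(eval_monom (\<lambda>e. \<Prod>v\<in>e. Var v) b :: ('v, 'k) mpoly)
      = (\<Prod>e\<in>Poly_Mapping.keys b. \<Prod>v\<in>e. Var v ^ Poly_Mapping.lookup b e)"
    unfolding eval_monom_def by (simp add: prod_power_distrib)
  also have "\<dots> = Poly_Mapping.single (vertex_degrees b) 1"
    unfolding Var_power prod_single_1 vertex_degrees_def ..
  finally show ?thesis
    by (simp add: toric_map_def mpoly_subst_single Const_times_single)
qed

lemma toric_map_sum: "toric_map (sum g F) = (\<Sum>i\<in>F. toric_map (g i))"
  by (simp add: toric_map_def mpoly_subst_sum)

lemma toric_map_eq:
  "toric_map p = (\<Sum>m\<in>Poly_Mapping.keys p. Poly_Mapping.single (vertex_degrees m) (Poly_Mapping.lookup p m))"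
  using poly_mapping_sum_single[OF finite_keys order_refl, of p]
  by (metis (no_types, lifting) sum.cong toric_map_single toric_map_sum)

lemma keys_toric_map: "Poly_Mapping.keys (toric_map p) \<subseteq> vertex_degrees ` Poly_Mapping.keys p"
proof -
  have "Poly_Mapping.lookup (toric_map p) m = 0" if "m \<notin> vertex_degrees ` Poly_Mapping.keys p" for m
    using that unfolding toric_map_eq lookup_sum by (auto intro!: sum.neutral simp: lookup_single when_def)
  then show ?thesis by (auto simp: in_keys_iff)
qed

lemma homogeneous_part_eq: "homogeneous_part S n = {p. Poly_Mapping.keys p \<subseteq> monomials S n}"
  by (auto simp: homogeneous_part_def monomials_def)

text \<open>As monomials go to monomials, it suffices to choose a preimage in \<open>M\<close> for
  every monomial of the target and to carry the coefficients along that choice.\<close>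

lemma toric_map_image:
  "toric_map ` {p. Poly_Mapping.keys p \<subseteq> M} = {p :: ('v, 'k::field) mpoly. Poly_Mapping.keys p \<subseteq> vertex_degrees ` M}"
proof (intro subset_antisym subsetI)
  fix p :: "('v, 'k) mpoly" assume "p \<in> {p. Poly_Mapping.keys p \<subseteq> vertex_degrees ` M}"
  then have p: "Poly_Mapping.keys p \<subseteq> vertex_degrees ` M" by simp
  then obtain s where s: "\<And>m. m \<in> Poly_Mapping.keys p \<Longrightarrow> s m \<in> M \<and> vertex_degrees (s m) = m"
    by (metis (mono_tags, lifting) image_iff subset_eq)
  let ?q = "\<Sum>m\<in>Poly_Mapping.keys p. Poly_Mapping.single (s m) (Poly_Mapping.lookup p m)"
  have "toric_map ?q = (\<Sum>m\<in>Poly_Mapping.keys p. Poly_Mapping.single m (Poly_Mapping.lookup p m))"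
    unfolding toric_map_sum toric_map_single by (intro sum.cong) (auto simp: s)
  also have "\<dots> = p"
    by (rule poly_mapping_sum_single[symmetric]) auto
  finally have "toric_map ?q = p" .
  moreover have "Poly_Mapping.lookup ?q b = 0" if "b \<notin> M" for b
    using that s unfolding lookup_sum by (intro sum.neutral) (auto simp: lookup_single when_def)
  then have "Poly_Mapping.keys ?q \<subseteq> M" by (auto simp: in_keys_iff)
  ultimately show "p \<in> toric_map ` {p. Poly_Mapping.keys p \<subseteq> M}"
    by (intro image_eqI[where x = ?q]) auto
next
  fix p :: "('v, 'k) mpoly" assume "p \<in> toric_map ` {p. Poly_Mapping.keys p \<subseteq> M}"
  then show "p \<in> {p. Poly_Mapping.keys p \<subseteq> vertex_degrees ` M}"
    using keys_toric_map by fastforce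
qed

section \<open>The quotient ring as a subalgebra of \<open>K[V]\<close>\<close>

locale toric_graph =
  fixes V :: "'v set" and E :: "'v set set"
    and A :: "('v set, 'k::field) mpoly set graded_algebra"
  assumes finite_edges: "finite E"
    and edges: "\<And>e. e \<in> E \<Longrightarrow> e \<subseteq> V \<and> finite e"
    and A_eq: "A = toric_ring V E"
begin

abbreviation R :: "('v set, 'k) mpoly ring" where "R \<equiv> mpoly_ring E"
abbreviation S :: "('v, 'k) mpoly ring" where "S \<equiv> mpoly_ring V"
abbreviation I :: "('v set, 'k) mpoly set" where "I \<equiv> toric_ideal V E"
abbreviation proj :: "('v set, 'k) mpoly \<Rightarrow> ('v set, 'k) mpoly set" where "proj p \<equiv> I +>\<^bsub>R\<^esub> p"

text \<open>The injection of \<open>K[E]/I\<close> into \<open>K[V]\<close> given by the first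
  isomorphism theorem: all elements of a coset of \<open>I\<close> share one image, which
  \<open>the_elem\<close> extracts.\<close>

definition emb :: "('v set, 'k) mpoly set \<Rightarrow> ('v, 'k) mpoly"
  where "emb x = the_elem (toric_map ` x)"

sublocale R: cring R by (rule cring_mpoly_ring)
sublocale S: cring S by (rule cring_mpoly_ring)

lemma prod_Var_in_S:
  assumes "e \<in> E" shows "(\<Prod>v\<in>e. Var v) \<in> carrier S"
proof (rule mpoly_ring_prod_closed)
  fix v assume "v \<in> e"
  then show "Var v \<in> carrier S" using edges[OF assms] by (auto simp: Var_def)
qed

sublocale hom: ring_hom_ring R S toric_map
  unfolding toric_map_def by (rule ring_hom_mpoly_subst[OF prod_Var_in_S])

lemma I_eq: "I = a_kernel R S toric_map"
  by (simp add: toric_ideal_def)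

lemma ideal_I: "ideal I R"
  unfolding I_eq by (rule hom.kernel_is_ideal)

lemma A_sel:
  "carrier A = carrier (R Quot I)" "monoid.mult A = monoid.mult (R Quot I)" "one A = one (R Quot I)"
  "zero A = zero (R Quot I)" "add A = add (R Quot I)" "scalars A = proj ` range Const"
  "component A n = proj ` homogeneous_part E n"
  by (auto simp: A_eq toric_ring_def Let_def ring.defs graded_algebra.defs)

text \<open>\<open>A\<close> has the ring operations of the quotient and only adds record fields, so
  the identity transports the ring structure from the quotient to \<open>A\<close>.\<close>

lemma id_hom_A: "id \<in> ring_iso (R Quot I) A"
  by (auto simp: ring_iso_def ring_hom_def A_sel cring.cring_simprules ring.ring_simprules
    ideal.quotient_is_ring[OF ideal_I])

sublocale A: cring A
proof -
  have "cring (R Quot I)"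
    by (rule ideal.quotient_is_cring[OF ideal_I R.is_cring])
  from cring.ring_iso_imp_img_cring[OF this id_hom_A] show "cring A"
    by (simp flip: A_sel)
qed

sublocale proj: ring_hom_ring R A proj
proof (rule ring_hom_ringI2)
  have "(+>\<^bsub>R\<^esub>) I \<in> ring_hom R (R Quot I)" by (rule ideal.rcos_ring_hom[OF ideal_I])
  then show "proj \<in> ring_hom R A" by (simp add: ring_hom_def A_sel)
qed unfold_locales

sublocale emb: ring_hom_ring A S emb
proof (rule ring_hom_ringI2)
  show "emb \<in> ring_hom A S"
    using hom.the_elem_hom by (simp add: ring_hom_def A_sel I_eq emb_def[abs_def])
qed unfold_locales

lemma emb_inj: "inj_on emb (carrier A)"
  unfolding A_sel I_eq emb_def by (rule inj_onI) (rule hom.the_elem_inj)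

lemma emb_proj: "p \<in> carrier R \<Longrightarrow> emb (proj p) = toric_map p"
  unfolding emb_def I_eq by (rule hom.the_elem_simp)

lemma A_cases:
  assumes "x \<in> carrier A" obtains p where "p \<in> carrier R" "x = proj p"
  using assms hom.quot_mem unfolding A_sel I_eq by blast

lemma one_neq_zero_A: "\<one>\<^bsub>A\<^esub> \<noteq> \<zero>\<^bsub>A\<^esub>"
proof
  assume "\<one>\<^bsub>A\<^esub> = \<zero>\<^bsub>A\<^esub>"
  then have "emb \<one>\<^bsub>A\<^esub> = emb \<zero>\<^bsub>A\<^esub>" by simp
  then show False by simp
qed

lemma subfield_scalars: "subfield (scalars A) A"
  unfolding A_sel by (rule proj.img_is_subfield(2)[OF subfield_Const one_neq_zero_A])

lemma emb_scalars: "emb ` scalars A = range Const"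
  unfolding A_sel image_image using emb_proj[OF Const_in_mpoly_ring]
  by (simp add: toric_map_def)

text \<open>\<open>Span\<close> is built by extending along one line at a time; at each stage the
  coefficient of the head monomial is split off.\<close>

lemma Span_monomials:
  assumes "set ms \<subseteq> {m. Poly_Mapping.keys m \<subseteq> V}"
  shows "S.Span (range Const) (map (\<lambda>m. Poly_Mapping.single m 1) ms) = {p. Poly_Mapping.keys p \<subseteq> set ms}"
  using assms
proof (induction ms)
  case (Cons m ms)
  have "S.line_extension (range Const) (Poly_Mapping.single m 1) {p. Poly_Mapping.keys p \<subseteq> set ms}
    = {p. Poly_Mapping.keys p \<subseteq> set (m # ms)}" (is "?L = ?R")
  proof (intro subset_antisym subsetI)
    fix p assume "p \<in> ?R"
    define c where "c = Poly_Mapping.lookup p m"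
    have "Poly_Mapping.keys (p - Poly_Mapping.single m c) \<subseteq> set ms"
      using \<open>p \<in> ?R\<close> by (auto simp: in_keys_iff c_def lookup_minus lookup_single when_def split: if_splits)
    moreover have "p = Const c * Poly_Mapping.single m 1 + (p - Poly_Mapping.single m c)"
      by (simp add: Const_times_single)
    ultimately show "p \<in> ?L"
      unfolding S.line_extension_mem_iff mpoly_ring_simps by blast
  next
    fix p assume "p \<in> ?L"
    then obtain c q where "p = Poly_Mapping.single m c + q" "Poly_Mapping.keys q \<subseteq> set ms"
      unfolding S.line_extension_mem_iff by (auto simp: Const_times_single)
    then show "p \<in> ?R" using keys_add[of "Poly_Mapping.single m c" q]
      by (auto split: if_splits)
  qed
  then show ?case using Cons by simp
qed auto

lemma independent_monomials:
  assumes "set ms \<subseteq> {m. Poly_Mapping.keys m \<subseteq> V}" "distinct ms"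
  shows "S.independent (range Const) (map (\<lambda>m. Poly_Mapping.single m 1) ms)"
  using assms
proof (induction ms)
  case (Cons m ms)
  have "Poly_Mapping.single m 1 \<notin> S.Span (range Const) (map (\<lambda>m. Poly_Mapping.single m 1) ms)"
    using Cons.prems by (subst Span_monomials) auto
  then show ?case using Cons by (auto simp del: S.Span.simps intro!: S.li_Cons)
qed auto

lemma vertex_degrees_in_V:
  assumes "Poly_Mapping.keys b \<subseteq> E" shows "Poly_Mapping.keys (vertex_degrees b) \<subseteq> V"
  using keys_vertex_degrees[of b] assms edges by blast

lemma homogeneous_part_subset: "homogeneous_part E n \<subseteq> carrier R"
  by (auto simp: homogeneous_part_def)

text \<open>\<open>emb\<close> carries \<open>component A n\<close> onto the span of the monomials
  in \<open>?M\<close>. Lifting these monomials back gives a basis of \<open>component A n\<close>,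
  because \<open>emb\<close> is injective and maps \<open>scalars A\<close> onto the
  constants.\<close>

lemma hilbert_function_toric_ring: "hilbert_function A n = card (vertex_degrees ` monomials E n)"
proof -
  let ?M = "vertex_degrees ` monomials E n"
  have "finite ?M" using finite_monomials[OF finite_edges] by auto
  then obtain ms where ms: "set ms = ?M" "distinct ms"
    using finite_distinct_list by blast
  have sub: "set ms \<subseteq> {m. Poly_Mapping.keys m \<subseteq> V}"
    unfolding ms using vertex_degrees_in_V by (auto simp: monomials_def)
  have emb_comp: "emb ` component A n = {p. Poly_Mapping.keys p \<subseteq> ?M}"
  proof -
    have "emb ` component A n = toric_map ` homogeneous_part E n"
      unfolding A_sel image_image using homogeneous_part_subset
      by (intro image_cong) (auto intro!: emb_proj simp del: mpoly_ring_simps)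
    then show ?thesis unfolding homogeneous_part_eq toric_map_image .
  qed
  have comp: "component A n \<subseteq> carrier A"
    unfolding A_sel(7) using homogeneous_part_subset proj.hom_closed by blast
  have "\<exists>x\<in>component A n. emb x = Poly_Mapping.single m 1" if "m \<in> set ms" for m
  proof -
    have "Poly_Mapping.single m 1 \<in> emb ` component A n"
      using that by (simp add: emb_comp ms)
    then show ?thesis by auto
  qed
  then obtain x where x: "\<And>m. m \<in> set ms \<Longrightarrow> x m \<in> component A n \<and> emb (x m) = Poly_Mapping.single m 1"
    by metis
  let ?xs = "map x ms"
  have xs: "set ?xs \<subseteq> carrier A" using x comp by auto
  have emb_xs: "map emb ?xs = map (\<lambda>m. Poly_Mapping.single m 1) ms" using x by auto
  have scal: "scalars A \<subseteq> carrier A" using subfieldE(3)[OF subfield_scalars] .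
  have "A.independent (scalars A) ?xs"
  \<comment> \<open>A nontrivial relation in \<open>A\<close> is sent by \<open>emb\<close> to a
    relation between distinct monomials. The images of its coefficients vanish, hence so do the
    coefficients.\<close>
  proof (rule ccontr)
    note K = subfield_scalars
    assume "A.dependent (scalars A) ?xs"
    then obtain Ks where Ks: "length Ks = length ?xs" "A.combine Ks ?xs = \<zero>\<^bsub>A\<^esub>" "set Ks \<subseteq> scalars A"
        "set Ks \<noteq> {\<zero>\<^bsub>A\<^esub>}"
      using A.dependent_imp_non_trivial_combine[OF K xs] by metis
    have "S.combine (map emb Ks) (map emb ?xs) = \<zero>\<^bsub>S\<^esub>"
      using emb.combine_hom[OF _ xs, of Ks] Ks scal by (simp add: subset_trans)
    moreover have "set (map emb Ks) \<subseteq> range Const"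
      using Ks(3) emb_scalars by auto
    ultimately have "set (take (length (map emb ?xs)) (map emb Ks)) \<subseteq> {\<zero>\<^bsub>S\<^esub>}"
      using S.independent_imp_trivial_combine[OF subfield_Const, of "map emb ?xs" "map emb Ks"]
        independent_monomials[OF sub ms(2)] unfolding emb_xs by blast
    then have *: "\<And>k. k \<in> set Ks \<Longrightarrow> emb k = emb \<zero>\<^bsub>A\<^esub>" using Ks(1) by auto
    have "k = \<zero>\<^bsub>A\<^esub>" if "k \<in> set Ks" for k
      by (rule inj_onD[OF emb_inj *]) (use that Ks(3) scal in auto)
    then have "Ks = []" using Ks(4) by (cases Ks) auto
    then show False using Ks(1) \<open>A.dependent (scalars A) ?xs\<close> by auto
  qed
  moreover have "A.Span (scalars A) ?xs = component A n"
  proof (rule inj_on_image_eq_iff[OF emb_inj _ comp, THEN iffD1])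
    show "A.Span (scalars A) ?xs \<subseteq> carrier A" by (rule A.Span_in_carrier[OF scal xs])
    show "emb ` A.Span (scalars A) ?xs = emb ` component A n"
      unfolding emb.Span_hom[OF scal xs, symmetric] emb_scalars emb_xs Span_monomials[OF sub] ms emb_comp ..
  qed
  ultimately have "A.dimension (length ?xs) (scalars A) (component A n)"
    using A.dimension_independent by metis
  from A.dimI[OF subfield_scalars this] show ?thesis
    using distinct_card[OF ms(2)] ms(1) by (simp add: hilbert_function_def over_def)
qed

end

section \<open>Krull dimension of toric rings of graphs\<close>

lemma primeideal_mpoly_ringD:
  fixes P :: "('v, 'k::field) mpoly set"
  assumes "primeideal P (mpoly_ring S)"
  shows primeideal_mpoly_subset: "p \<in> P \<Longrightarrow> p \<in> carrier (mpoly_ring S)"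
    and primeideal_mpoly_add: "p \<in> P \<Longrightarrow> q \<in> P \<Longrightarrow> p + q \<in> P"
    and primeideal_mpoly_absorb: "p \<in> carrier (mpoly_ring S) \<Longrightarrow> q \<in> P \<Longrightarrow> p * q \<in> P"
    and primeideal_mpoly_prime: "p \<in> carrier (mpoly_ring S) \<Longrightarrow> q \<in> carrier (mpoly_ring S) \<Longrightarrow>
      p * q \<in> P \<Longrightarrow> p \<in> P \<or> q \<in> P"
    and primeideal_mpoly_proper: "1 \<notin> P"
proof -
  interpret primeideal P "mpoly_ring S" by (rule assms)
  show "p \<in> P \<Longrightarrow> p \<in> carrier (mpoly_ring S)" by (rule a_Hcarr)
  show "p \<in> P \<Longrightarrow> q \<in> P \<Longrightarrow> p + q \<in> P" using additive_subgroup.a_closed[OF additive_subgroup_axioms, of p q] by simp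
  show "p \<in> carrier (mpoly_ring S) \<Longrightarrow> q \<in> P \<Longrightarrow> p * q \<in> P" using I_l_closed[of q p] by simp
  show "p \<in> carrier (mpoly_ring S) \<Longrightarrow> q \<in> carrier (mpoly_ring S) \<Longrightarrow>
      p * q \<in> P \<Longrightarrow> p \<in> P \<or> q \<in> P" using I_prime[of p q] by simp
  show "1 \<notin> P" using one_imp_carrier I_notcarr by auto
qed

lemma primeideal_mpoly_sum:
  assumes "primeideal P (mpoly_ring S)" "\<And>i. i \<in> F \<Longrightarrow> g i \<in> P"
  shows "sum g F \<in> P"
proof -
  interpret primeideal P "mpoly_ring S" by (rule assms)
  have "0 \<in> P" using additive_subgroup.zero_closed[OF additive_subgroup_axioms] by simp
  then show ?thesis using assms(2)
    by (induction F rule: infinite_finite_induct) (auto intro: primeideal_mpoly_add[OF assms(1)])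
qed

lemma primeideal_mpoly_power:
  assumes "primeideal P (mpoly_ring S)" "p \<in> carrier (mpoly_ring S)" "p ^ n \<in> P"
  shows "p \<in> P"
  using assms(3)
proof (induction n)
  case (Suc n)
  then show ?case
    using primeideal_mpoly_prime[OF assms(1,2) mpoly_ring_power_closed[OF assms(2)]] by auto
qed (use primeideal_mpoly_proper[OF assms(1)] in auto)

lemma primeideal_mpoly_Const:
  assumes "primeideal P (mpoly_ring S)" "Const c \<in> P"
  shows "c = 0"
proof (rule ccontr)
  assume "c \<noteq> 0"
  then have "1 = Const (inverse c) * Const c" by (simp flip: Const_mult)
  also have "\<dots> \<in> P" by (rule primeideal_mpoly_absorb[OF assms(1) Const_in_mpoly_ring assms(2)])
  finally show False using primeideal_mpoly_proper[OF assms(1)] by simp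
qed

text \<open>
  In a relation that lies in \<open>Q i\<close>, cancel the largest power of \<open>x i\<close>, which is not in
  \<open>Q i\<close>. The terms that still contain \<open>x i\<close> lie in \<open>Q (Suc i)\<close>, hence so does the
  sum of the others, which involves fewer variables.
\<close>

lemma prime_chain_algebraically_independent:
  fixes Q :: "nat \<Rightarrow> ('v, 'k::field) mpoly set"
  assumes prime: "\<And>i. i \<le> m \<Longrightarrow> primeideal (Q i) (mpoly_ring S)"
    and mono: "\<And>i. i < m \<Longrightarrow> Q i \<subseteq> Q (Suc i)"
    and x: "\<And>i. i < m \<Longrightarrow> x i \<in> Q (Suc i) - Q i"
    and "i \<le> m" "finite F" "F \<subseteq> extensional {i..<m}"
    and "(\<Sum>a\<in>F. Const (c a) * (\<Prod>j\<in>{i..<m}. x j ^ a j)) \<in> Q i" "a \<in> F"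
  shows "c a = 0"
  using assms(4-)
proof (induction i arbitrary: F c a rule: inc_induct)
  case base
  \<comment> \<open>Over an empty index range there is a single exponent vector, so the relation is
    a constant that lies in a proper ideal.\<close>
  then have "F = {\<lambda>_. undefined}" by auto
  with base have "Const (c a) \<in> Q m" by auto
  then show ?case using primeideal_mpoly_Const prime by blast
next
  case (step n)
  show ?case
  proof (rule ccontr)
    assume "c a \<noteq> 0"
    have xC: "x j \<in> carrier (mpoly_ring S)" if "j < m" for j
      using x[OF that] primeideal_mpoly_subset[OF prime[of "Suc j"]] that by auto
    \<comment> \<open>Terms with coefficient zero are discarded, so that the least exponent
      \<open>k\<close> of \<open>x n\<close> is attained by a term that is really present.\<close>
    define G where "G = {a\<in>F. c a \<noteq> 0}"
    have G: "finite G" "a \<in> G" "G \<subseteq> F"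
      using step.prems \<open>c a \<noteq> 0\<close> by (auto simp: G_def)
    define k where "k = Min ((\<lambda>a. a n) ` G)"
    have k_le: "k \<le> b n" if "b \<in> G" for b using that G by (auto simp: k_def)
    have "k \<in> (\<lambda>a. a n) ` G" unfolding k_def using G by (intro Min_in) auto
    then obtain b0 where b0: "b0 \<in> G" "b0 n = k" by auto
    define y where "y b = (\<Prod>j\<in>{Suc n..<m}. x j ^ b j)" for b
    have yC: "y b \<in> carrier (mpoly_ring S)" for b
      unfolding y_def using xC by (intro mpoly_ring_prod_closed mpoly_ring_power_closed) auto
    define rest where "rest b = Const (c b) * (x n ^ (b n - k) * y b)" for b
    have restC: "rest b \<in> carrier (mpoly_ring S)" for b
      unfolding rest_def using xC step.hyps yC
      by (intro mpoly_ring_mult_closed mpoly_ring_power_closed Const_in_mpoly_ring) auto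
    have "(\<Sum>b\<in>F. Const (c b) * (\<Prod>j\<in>{n..<m}. x j ^ b j)) = (\<Sum>b\<in>G. Const (c b) * (\<Prod>j\<in>{n..<m}. x j ^ b j))"
      using step.prems by (intro sum.mono_neutral_right) (auto simp: G_def)
    also have "\<dots> = (\<Sum>b\<in>G. x n ^ k * rest b)"
    proof (intro sum.cong refl)
      fix b assume "b \<in> G"
      have "(\<Prod>j\<in>{n..<m}. x j ^ b j) = x n ^ b n * y b"
        unfolding y_def using step.hyps by (simp add: prod.atLeast_Suc_lessThan)
      also have "x n ^ b n = x n ^ k * x n ^ (b n - k)"
        using k_le[OF \<open>b \<in> G\<close>] by (simp flip: power_add)
      finally show "Const (c b) * (\<Prod>j\<in>{n..<m}. x j ^ b j) = x n ^ k * rest b"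
        by (simp add: rest_def mult_ac)
    qed
    also have "\<dots> = x n ^ k * sum rest G" by (simp add: sum_distrib_left)
    finally have "x n ^ k * sum rest G \<in> Q n" using step.prems by simp
    moreover have "x n ^ k \<notin> Q n"
      using primeideal_mpoly_power[OF prime[of n] xC] x step.hyps by auto
    ultimately have "sum rest G \<in> Q n"
      using primeideal_mpoly_prime[OF prime[of n] mpoly_ring_power_closed[OF xC] mpoly_ring_sum_closed]
        restC step.hyps by (metis less_imp_le)
    then have in_Q: "sum rest G \<in> Q (Suc n)" using mono step.hyps by blast
    define G0 where "G0 = {b\<in>G. b n = k}"
    have "rest b \<in> Q (Suc n)" if "b \<in> G - G0" for b
    proof -
      have "k < b n" using that k_le[of b] by (force simp: G0_def)
      then obtain l where "b n - k = Suc l" by (metis Suc_diff_Suc)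
      then have "rest b = (Const (c b) * (x n ^ l * y b)) * x n"
        by (simp add: rest_def mult_ac)
      also have "\<dots> \<in> Q (Suc n)"
        using step.hyps x xC yC
        by (intro primeideal_mpoly_absorb[OF prime] mpoly_ring_mult_closed mpoly_ring_power_closed
            Const_in_mpoly_ring) auto
      finally show ?thesis .
    qed
    then have "sum rest (G - G0) \<in> Q (Suc n)"
      using primeideal_mpoly_sum[OF prime] step.hyps by (metis Suc_leI)
    then have "- 1 * sum rest (G - G0) \<in> Q (Suc n)"
      using primeideal_mpoly_absorb[OF prime[of "Suc n"] Const_in_mpoly_ring[of "-1"]] step.hyps
      by (simp add: Const_uminus)
    from primeideal_mpoly_add[OF prime in_Q this] step.hyps
    have "sum rest G - sum rest (G - G0) \<in> Q (Suc n)" by simp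
    also have "sum rest G - sum rest (G - G0) = sum rest G0"
      using G sum_diff[of G "G - G0" rest] by (simp add: G0_def double_diff)
    \<comment> \<open>On \<open>G0\<close> the exponent at \<open>n\<close> is always
      \<open>k\<close>, so erasing it is injective and leaves exponent vectors that are extensional
      on \<open>{Suc n..<m}\<close>. The new coefficient function puts \<open>k\<close> back at
      \<open>n\<close>.\<close>
    also have "sum rest G0 = (\<Sum>b\<in>(\<lambda>b. b(n := undefined)) ` G0. Const (c (b(n := k))) * (\<Prod>j\<in>{Suc n..<m}. x j ^ b j))"
    proof (subst sum.reindex)
      show "inj_on (\<lambda>b. b(n := undefined)) G0"
      proof (rule inj_onI, rule ext)
        fix b b' j assume "b \<in> G0" "b' \<in> G0" "b(n := undefined) = b'(n := undefined)"
        then show "b j = b' j" by (cases "j = n") (auto simp: G0_def dest: fun_cong[of _ _ j])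
      qed
      show "sum rest G0 = sum ((\<lambda>b. Const (c (b(n := k))) * (\<Prod>j\<in>{Suc n..<m}. x j ^ b j)) \<circ> (\<lambda>b. b(n := undefined))) G0"
      proof (intro sum.cong refl)
        fix b assume "b \<in> G0"
        then have [simp]: "b(n := k) = b" "b n = k" by (auto simp: G0_def)
        have "(\<Prod>j\<in>{Suc n..<m}. x j ^ (b(n := undefined)) j) = y b"
          unfolding y_def by (intro prod.cong) auto
        then show "rest b = ((\<lambda>b. Const (c (b(n := k))) * (\<Prod>j\<in>{Suc n..<m}. x j ^ b j)) \<circ> (\<lambda>b. b(n := undefined))) b"
          unfolding o_def rest_def by simp
      qed
    qed
    finally have *: "(\<Sum>b\<in>(\<lambda>b. b(n := undefined)) ` G0. Const (c (b(n := k))) * (\<Prod>j\<in>{Suc n..<m}. x j ^ b j)) \<in> Q (Suc n)" .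
    have b0': "b0 \<in> G0" using b0 by (simp add: G0_def)
    have "c ((b0(n := undefined))(n := k)) = 0"
    proof (rule step.IH[OF _ _ *])
      show "finite ((\<lambda>b. b(n := undefined)) ` G0)" using G by (simp add: G0_def)
      show "(\<lambda>b. b(n := undefined)) ` G0 \<subseteq> extensional {Suc n..<m}"
        using step.prems by (auto simp: G0_def G_def extensional_def)
    qed (use b0' in blast)
    moreover have "(b0(n := undefined))(n := k) = b0" using b0 by auto
    ultimately show False using b0 by (simp add: G_def)
  qed
qed

text \<open>If \<open>n > w\<close>, take \<open>N = (K + 1) ^ w\<close>: the right side is at most
  \<open>N * (N + 1) ^ w\<close>, which is less than \<open>(N + 1) ^ Suc w\<close>.\<close>

lemma exponent_le_if_power_bound:
  assumes "\<And>N. (N + 1) ^ n \<le> (K * N + 1 :: nat) ^ w"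
  shows "n \<le> w"
proof (rule ccontr)
  assume "\<not> n \<le> w"
  define N where "N = (K + 1) ^ w"
  have "(N + 1) ^ Suc w \<le> (N + 1) ^ n"
    using \<open>\<not> n \<le> w\<close> by (intro power_increasing) auto
  also have "\<dots> \<le> (K * N + 1) ^ w" by (rule assms)
  also have "\<dots> \<le> ((K + 1) * (N + 1)) ^ w" by (intro power_mono) auto
  also have "\<dots> = (K + 1) ^ w * (N + 1) ^ w" by (rule power_mult_distrib)
  also have "(K + 1) ^ w = N" by (simp add: N_def)
  finally show False by simp
qed

section \<open>The filtration of the polynomial ring by degree\<close>

definition degree_le_part :: "'v set \<Rightarrow> nat \<Rightarrow> ('v, 'k::field) mpoly set"
  where "degree_le_part S n = {p. Poly_Mapping.keys p \<subseteq> {m. Poly_Mapping.keys m \<subseteq> S \<and> monomial_degree m \<le> n}}"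

lemma degree_le_part_one: "1 \<in> degree_le_part S n"
  by (auto simp: degree_le_part_def monomial_degree_def)

lemma degree_le_part_mult:
  assumes "p \<in> degree_le_part S a" "q \<in> degree_le_part S b"
  shows "p * q \<in> degree_le_part S (a + b)"
proof -
  have "Poly_Mapping.keys m \<subseteq> S \<and> monomial_degree m \<le> a + b" if m: "m \<in> Poly_Mapping.keys (p * q)" for m
  proof -
    obtain m1 m2 where m12: "m = m1 + m2" "m1 \<in> Poly_Mapping.keys p" "m2 \<in> Poly_Mapping.keys q"
      using keys_mult[of p q] m by auto
    then have "Poly_Mapping.keys m1 \<subseteq> S" "Poly_Mapping.keys m2 \<subseteq> S" "monomial_degree m1 \<le> a" "monomial_degree m2 \<le> b"
      using assms by (auto simp: degree_le_part_def)
    then show ?thesis using m12 keys_add[of m1 m2] by (auto simp: monomial_degree_add)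
  qed
  then show ?thesis by (auto simp: degree_le_part_def)
qed

lemma degree_le_part_power: "p \<in> degree_le_part S a \<Longrightarrow> p ^ n \<in> degree_le_part S (n * a)"
  by (induction n) (auto intro: degree_le_part_one degree_le_part_mult)

lemma degree_le_part_prod:
  "(\<And>i. i \<in> F \<Longrightarrow> g i \<in> degree_le_part S (a i)) \<Longrightarrow> prod g F \<in> degree_le_part S (sum a F)"
  by (induction F rule: infinite_finite_induct) (auto intro: degree_le_part_one degree_le_part_mult)

lemma degree_le_part_mono: "p \<in> degree_le_part S a \<Longrightarrow> a \<le> b \<Longrightarrow> p \<in> degree_le_part S b"
  by (auto simp: degree_le_part_def)

lemma mpoly_ring_degree_bound:
  assumes "p \<in> carrier (mpoly_ring S)"
  obtains n where "p \<in> degree_le_part S n"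
proof
  \<comment> \<open>Inserting \<open>0\<close> keeps the maximum meaningful for the zero
    polynomial.\<close>
  show "p \<in> degree_le_part S (Max (insert 0 (monomial_degree ` Poly_Mapping.keys p)))"
    using assms by (auto simp: degree_le_part_def)
qed

text \<open>Gives access to the bound on the size of an independent set by that of a spanning set,
  used to compare monomial counts.\<close>

lemma vector_space_mpoly: "vector_space (\<lambda>c p. Const c * p :: ('v, 'k::field) mpoly)"
  by unfold_locales (simp_all add: algebra_simps Const_add Const_mult)

context toric_graph
begin

text \<open>\<open>W\<close> is a set of vertices whose degrees determine the whole degree vector,
  so at most \<open>(K * N + 1) ^ card W\<close> vectors arise from monomials of degree at most
  \<open>K * N\<close>. Comparing this with \<open>(N + 1) ^ n\<close> independent products for all
  \<open>N\<close> bounds the length \<open>n\<close> of the chain.\<close>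

lemma prime_chain_length_le:
  assumes W: "finite W"
    and inj: "\<And>a b. Poly_Mapping.keys a \<subseteq> E \<Longrightarrow> Poly_Mapping.keys b \<subseteq> E \<Longrightarrow>
      (\<And>v. v \<in> W \<Longrightarrow> Poly_Mapping.lookup (vertex_degrees a) v = Poly_Mapping.lookup (vertex_degrees b) v) \<Longrightarrow>
      vertex_degrees a = vertex_degrees b"
    and P: "\<And>i. i \<le> n \<Longrightarrow> primeideal (P i) A" "\<And>i. i < n \<Longrightarrow> P i \<subset> P (Suc i)"
  shows "n \<le> card W"
proof -
  define Q where "Q i = {p \<in> carrier R. proj p \<in> P i}" for i
  have Q_prime: "primeideal (Q i) R" if "i \<le> n" for i
    unfolding Q_def by (rule proj.primeideal_vimage[OF R.is_cring P(1)[OF that]])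
  have Q_mono: "Q i \<subseteq> Q (Suc i)" if "i < n" for i
    using P(2)[OF that] by (auto simp: Q_def)
  have "\<exists>p. p \<in> Q (Suc i) - Q i" if i: "i < n" for i
  proof -
    obtain a where a: "a \<in> P (Suc i)" "a \<notin> P i" using P(2)[OF i] by blast
    interpret primeideal "P (Suc i)" A using P(1) i by auto
    obtain p where "p \<in> carrier R" "a = proj p" using A_cases[OF a_Hcarr[OF a(1)]] .
    then show ?thesis using a by (intro exI[of _ p]) (simp add: Q_def del: mpoly_ring_simps)
  qed
  then obtain x where x: "\<And>i. i < n \<Longrightarrow> x i \<in> Q (Suc i) - Q i" by metis
  have xR: "x i \<in> carrier R" if "i < n" for i using x[OF that] by (auto simp: Q_def)
  have "\<exists>k. x i \<in> degree_le_part E k" if "i < n" for i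
    using mpoly_ring_degree_bound[OF xR[OF that]] by metis
  then obtain k where k: "\<And>i. i < n \<Longrightarrow> x i \<in> degree_le_part E (k i)" by metis
  define K where "K = (\<Sum>i<n. k i)"
  define y where "y a = (\<Prod>j\<in>{0..<n}. x j ^ a j)" for a :: "nat \<Rightarrow> nat"
  have yR: "y a \<in> carrier R" for a
    unfolding y_def using xR by (intro mpoly_ring_prod_closed mpoly_ring_power_closed) auto
  \<comment> \<open>A relation between images under \<open>toric_map\<close> is a relation modulo
    \<open>I\<close>, so it lies in \<open>Q 0\<close>, the preimage of the first prime, and the
    algebraic independence along the chain applies.\<close>
  have no_relation: "c a = 0"
    if "finite F" "F \<subseteq> extensional {0..<n}" "toric_map (\<Sum>a\<in>F. Const (c a) * y a) = 0" "a \<in> F" for F c a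
  proof -
    let ?s = "\<Sum>a\<in>F. Const (c a) * y a"
    have s: "?s \<in> carrier R"
      using yR by (intro mpoly_ring_sum_closed mpoly_ring_mult_closed Const_in_mpoly_ring) auto
    interpret primeideal "P 0" A using P(1) by auto
    have "emb (proj ?s) = emb \<zero>\<^bsub>A\<^esub>" using that(3) emb_proj[OF s] by simp
    then have "proj ?s = \<zero>\<^bsub>A\<^esub>" using inj_onD[OF emb_inj] proj.hom_closed[OF s] by auto
    then have "?s \<in> Q 0" using s additive_subgroup.zero_closed[OF additive_subgroup_axioms] by (simp add: Q_def del: mpoly_ring_simps)
    then show ?thesis
      using prime_chain_algebraically_independent[where Q = Q and i = 0 and F = F and c = c and x = x, OF Q_prime Q_mono x _ that(1,2)]
        that(4) by (simp add: y_def)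
  qed
  have "(N + 1) ^ n \<le> (K * N + 1) ^ card W" for N
  proof -
    interpret vs: vector_space "\<lambda>c p. Const c * p :: ('v, 'k) mpoly" by (rule vector_space_mpoly)
    define box where "box = {0..<n} \<rightarrow>\<^sub>E {..N}"
    define g where "g a = toric_map (y a)" for a
    have box: "finite box" "box \<subseteq> extensional {0..<n}"
      unfolding box_def by (simp add: finite_PiE) (auto simp: PiE_def)
    have toric_lin: "toric_map (\<Sum>a\<in>F. Const (c a) * y a) = (\<Sum>a\<in>F. Const (c a) * g a)" for F c
      unfolding g_def toric_map_def mpoly_subst_sum by (simp add: mpoly_subst_mult)
    have g_inj: "inj_on g box"
    proof (rule inj_onI, rule ccontr)
      fix a b assume ab: "a \<in> box" "b \<in> box" "g a = g b" "a \<noteq> b"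
      \<comment> \<open>Two exponent vectors with the same image would give a relation with
        coefficients \<open>1\<close> and \<open>- 1\<close>.\<close>
      let ?c = "\<lambda>u. if u = a then 1 else - 1 :: 'k"
      have "toric_map (\<Sum>u\<in>{a, b}. Const (?c u) * y u) = 0"
        unfolding toric_lin using ab by (simp add: Const_uminus)
      from no_relation[OF _ _ this, of a] show False using ab box by auto
    qed
    define B where "B = {m. Poly_Mapping.keys m \<subseteq> E \<and> monomial_degree m \<le> K * N}"
    have B: "finite B" unfolding B_def by (rule finite_monomials_degree_le[OF finite_edges])
    define T where "T = (\<lambda>m. Poly_Mapping.single m (1 :: 'k)) ` vertex_degrees ` B"
    have T: "finite T" using B by (simp add: T_def)
    have "vs.independent (g ` box)"
    proof (rule vs.independent_if_scalars_zero)
      fix f p assume f: "(\<Sum>p\<in>g ` box. Const (f p) * p) = 0" and p: "p \<in> g ` box"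
      then obtain a where a: "a \<in> box" "p = g a" by auto
      have "toric_map (\<Sum>a\<in>box. Const (f (g a)) * y a) = 0"
        unfolding toric_lin using f by (simp add: sum.reindex[OF g_inj] o_def)
      from no_relation[OF box this a(1)] show "f p = 0" by (simp add: a)
    qed (use box in simp)
    moreover have "g ` box \<subseteq> vs.span T"
    proof
      fix p assume "p \<in> g ` box"
      then obtain a where a: "a \<in> box" "p = g a" by auto
      have "y a \<in> degree_le_part E (\<Sum>j\<in>{0..<n}. a j * k j)"
        unfolding y_def using k by (intro degree_le_part_prod degree_le_part_power) auto
      moreover have "(\<Sum>j\<in>{0..<n}. a j * k j) \<le> (\<Sum>j\<in>{0..<n}. N * k j)"
        using a by (intro sum_mono mult_right_mono) (auto simp: box_def)
      moreover have "(\<Sum>j\<in>{0..<n}. N * k j) = K * N"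
        by (simp add: K_def sum_distrib_left mult.commute atLeast0LessThan)
      ultimately have "y a \<in> degree_le_part E (K * N)"
        using degree_le_part_mono by metis
      then have "Poly_Mapping.keys p \<subseteq> vertex_degrees ` B"
        using keys_toric_map[of "y a"] unfolding a g_def degree_le_part_def B_def by blast
      then have "Const (Poly_Mapping.lookup p m) * Poly_Mapping.single m 1 \<in> vs.span T"
        if "m \<in> Poly_Mapping.keys p" for m
        using that by (intro vs.span_scale vs.span_base) (auto simp: T_def)
      then have "(\<Sum>m\<in>Poly_Mapping.keys p. Poly_Mapping.single m (Poly_Mapping.lookup p m)) \<in> vs.span T"
        by (intro vs.span_sum) (simp add: Const_times_single)
      then show "p \<in> vs.span T" using poly_mapping_sum_single[OF finite_keys order_refl, of p] by simp
    qed
    ultimately have "card (g ` box) \<le> card T"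
      using vs.independent_span_bound[OF T] by blast
    also have "card T \<le> card (vertex_degrees ` B)"
      unfolding T_def using B by (intro card_image_le) simp
    \<comment> \<open>By the hypothesis on \<open>W\<close>, restricting a degree vector to
      \<open>W\<close> loses no information.\<close>
    also have "\<dots> = card ((\<lambda>m. restrict (Poly_Mapping.lookup m) W) ` vertex_degrees ` B)"
    proof (rule card_image[symmetric], rule inj_onI)
      fix u v assume uv: "u \<in> vertex_degrees ` B" "v \<in> vertex_degrees ` B"
        "restrict (Poly_Mapping.lookup u) W = restrict (Poly_Mapping.lookup v) W"
      then obtain a b where ab: "a \<in> B" "u = vertex_degrees a" "b \<in> B" "v = vertex_degrees b" by auto
      have "Poly_Mapping.lookup u w = Poly_Mapping.lookup v w" if "w \<in> W" for w
        using fun_cong[OF uv(3), of w] that by simp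
      then show "u = v" using inj[of a b] ab by (simp add: B_def)
    qed
    also have "\<dots> \<le> card (W \<rightarrow>\<^sub>E {..K * N})"
    proof (rule card_mono)
      have "Poly_Mapping.lookup (vertex_degrees b) v \<le> K * N" if "b \<in> B" for b v
        using lookup_vertex_degrees_le[of b v] edges that by (force simp: B_def)
      then show "(\<lambda>m. restrict (Poly_Mapping.lookup m) W) ` vertex_degrees ` B \<subseteq> W \<rightarrow>\<^sub>E {..K * N}"
        by auto
    qed (use W in \<open>auto intro: finite_PiE\<close>)
    also have "\<dots> = (K * N + 1) ^ card W" using W by (simp add: card_PiE)
    finally show ?thesis
      using card_image[OF g_inj] by (simp add: box_def card_PiE)
  qed
  then show ?thesis by (rule exponent_le_if_power_bound)
qed

lemma krull_dim_le:
  assumes "finite W"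
    and "\<And>a b. Poly_Mapping.keys a \<subseteq> E \<Longrightarrow> Poly_Mapping.keys b \<subseteq> E \<Longrightarrow>
      (\<And>v. v \<in> W \<Longrightarrow> Poly_Mapping.lookup (vertex_degrees a) v = Poly_Mapping.lookup (vertex_degrees b) v) \<Longrightarrow>
      vertex_degrees a = vertex_degrees b"
  shows "krull_dim A \<le> enat (card W)"
  unfolding krull_dim_def
proof (rule Sup_least)
  fix l assume "l \<in> {enat n |n. \<exists>P. (\<forall>i\<le>n. primeideal (P i) A) \<and> (\<forall>i<n. P i \<subset> P (Suc i))}"
  then obtain n P where l: "l = enat n"
    and P: "\<And>i. i \<le> n \<Longrightarrow> primeideal (P i) A" "\<And>i. i < n \<Longrightarrow> P i \<subset> P (Suc i)" by blast
  have "n \<le> card W"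
    by (rule prime_chain_length_le[of W n P]) (fact assms P)+
  then show "l \<le> enat (card W)" by (simp add: l)
qed

end

section \<open>Lower bound for the Krull dimension\<close>

definition restrict_away :: "'v set \<Rightarrow> ('v, 'k::field) mpoly \<Rightarrow> ('v, 'k) mpoly"
  where "restrict_away W = mpoly_subst (\<lambda>v. if v \<in> W then 0 else Var v)"

lemma lookup_restrict_away:
  fixes p :: "('v, 'k::field) mpoly"
  shows "Poly_Mapping.lookup (restrict_away W p) m = (if Poly_Mapping.keys m \<inter> W = {} then Poly_Mapping.lookup p m else 0)"
proof -
  have monom: "eval_monom (\<lambda>v. if v \<in> W then 0 else Var v) m
    = (if Poly_Mapping.keys m \<inter> W = {} then Poly_Mapping.single m 1 else (0 :: ('v, 'k) mpoly))" for m
  proof (cases "Poly_Mapping.keys m \<inter> W = {}")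
    case True
    then have "eval_monom (\<lambda>v. if v \<in> W then 0 else Var v) m = (eval_monom Var m :: ('v, 'k) mpoly)"
      unfolding eval_monom_def by (intro prod.cong) auto
    then show ?thesis using True by (simp add: eval_monom_Var)
  next
    case False
    then obtain v where "v \<in> Poly_Mapping.keys m" "v \<in> W" by blast
    then have "eval_monom (\<lambda>v. if v \<in> W then 0 else Var v) m = (0 :: ('v, 'k) mpoly)"
      unfolding eval_monom_def by (intro prod_zero bexI[of _ v]) (auto simp: in_keys_iff power_0_left)
    then show ?thesis using False by simp
  qed
  have "Poly_Mapping.lookup (restrict_away W p) m
    = (\<Sum>u\<in>Poly_Mapping.keys p. if u = m then (if Poly_Mapping.keys m \<inter> W = {} then Poly_Mapping.lookup p m else 0) else 0)"
    unfolding restrict_away_def mpoly_subst_superset[OF finite_keys order_refl] lookup_sum monom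
    by (intro sum.cong) (auto simp: Const_times_single lookup_single when_def)
  then show ?thesis by (auto simp: in_keys_iff)
qed

lemma Var_neq_0: "Var v \<noteq> 0"
  unfolding Var_def by (metis lookup_single_eq lookup_zero zero_neq_one)

lemma restrict_away_eq_0_iff:
  "restrict_away W p = 0 \<longleftrightarrow> (\<forall>m\<in>Poly_Mapping.keys p. Poly_Mapping.keys m \<inter> W \<noteq> {})"
  unfolding poly_mapping_eq_iff fun_eq_iff lookup_restrict_away by (auto simp: in_keys_iff[of _ p])

text \<open>\<open>P i\<close> is the kernel of \<open>emb\<close> followed by setting the variables
  in \<open>W i\<close> to zero; it is prime because \<open>K[V]\<close> is a domain. The class of
  an edge that avoids \<open>W i\<close> but meets \<open>W (Suc i)\<close> shows that the inclusion
  is strict.\<close>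

lemma krull_dim_ge:
  fixes V :: "'v::linorder set" and A :: "('v set, 'k::field) mpoly set graded_algebra"
  assumes "toric_graph V E A"
    and W: "\<And>i. i < n \<Longrightarrow> W i \<subseteq> W (Suc i)"
    and e: "\<And>i. i < n \<Longrightarrow> \<exists>e\<in>E. e \<inter> W i = {} \<and> e \<inter> W (Suc i) \<noteq> {}"
  shows "enat n \<le> krull_dim A"
proof -
  interpret toric_graph V E A by (rule assms)
  define P where "P i = {x \<in> carrier A. restrict_away (W i) (emb x) = 0}" for i
  have prime: "primeideal (P i) A" for i
  proof -
    have "ring_hom_ring S S (restrict_away (W i))"
      unfolding restrict_away_def by (rule ring_hom_mpoly_subst) (auto simp: Var_def)
    from ring_hom_ring.primeideal_vimage[OF this S.is_cring domain.zeroprimeideal[OF domain_mpoly_ring]]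
    have "primeideal {p \<in> carrier S. restrict_away (W i) p \<in> {\<zero>\<^bsub>S\<^esub>}} S" .
    from emb.primeideal_vimage[OF A.is_cring this]
    have "primeideal {x \<in> carrier A. emb x \<in> {p \<in> carrier S. restrict_away (W i) p \<in> {\<zero>\<^bsub>S\<^esub>}}} A" .
    also have "{x \<in> carrier A. emb x \<in> {p \<in> carrier S. restrict_away (W i) p \<in> {\<zero>\<^bsub>S\<^esub>}}} = P i"
      unfolding P_def using emb.hom_closed by (auto simp del: mpoly_ring_simps(1))
    finally show ?thesis .
  qed
  have strict: "P i \<subset> P (Suc i)" if i: "i < n" for i
  proof (rule psubsetI)
    show "P i \<subseteq> P (Suc i)"
      using W[OF i] unfolding P_def restrict_away_eq_0_iff by blast
    obtain e where e: "e \<in> E" "e \<inter> W i = {}" "e \<inter> W (Suc i) \<noteq> {}" using e[OF i] by blast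
    have VarR: "Var e \<in> carrier R" using e by (auto simp: Var_def)
    have emb: "emb (proj (Var e)) = (\<Prod>v\<in>e. Var v)"
      using emb_proj[OF VarR] by (simp add: toric_map_def)
    have ra: "restrict_away U (\<Prod>v\<in>e. Var v) = (\<Prod>v\<in>e. if v \<in> U then 0 else Var v :: ('v, 'k) mpoly)" for U
    proof -
      have "restrict_away U (prod f F) = (\<Prod>i\<in>F. restrict_away U (f i))" for F and f :: "'v \<Rightarrow> ('v, 'k) mpoly"
        unfolding restrict_away_def by (induction F rule: infinite_finite_induct) (auto simp: mpoly_subst_mult)
      then show ?thesis by (simp add: restrict_away_def)
    qed
    have "proj (Var e) \<in> carrier A" using VarR by (rule proj.hom_closed)
    moreover have "restrict_away (W (Suc i)) (\<Prod>v\<in>e. Var v) = (0 :: ('v, 'k) mpoly)"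
      unfolding ra using e edges by (auto intro: prod_zero)
    moreover have "restrict_away (W i) (\<Prod>v\<in>e. Var v) \<noteq> (0 :: ('v, 'k) mpoly)"
      unfolding ra using e edges by (auto simp: Var_neq_0)
    ultimately have "proj (Var e) \<in> P (Suc i)" "proj (Var e) \<notin> P i"
      by (auto simp: P_def emb)
    then show "P i \<noteq> P (Suc i)" by blast
  qed
  show ?thesis
    unfolding krull_dim_def using prime strict by (intro Sup_upper) auto
qed

section \<open>Counting normal forms\<close>

unbundle fps_syntax

text \<open>An infinite fibre would contribute the coefficient \<open>0\<close>, by the convention
  for \<open>card\<close>; hence the finiteness assumptions in the rules for sums and
  products.\<close>

definition gen_fun :: "('a \<Rightarrow> nat) \<Rightarrow> 'a set \<Rightarrow> int fps"
  where "gen_fun w S = Abs_fps (\<lambda>n. int (card {x\<in>S. w x = n}))"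

lemma gen_fun_nth: "gen_fun w S $ n = int (card {x\<in>S. w x = n})"
  by (simp add: gen_fun_def)

lemma gen_fun_bij_betw:
  assumes "bij_betw f S T" "\<And>x. x \<in> S \<Longrightarrow> w (f x) = v x"
  shows "gen_fun w T = gen_fun v S"
proof (rule fps_ext)
  fix n
  have "bij_betw f {x\<in>S. v x = n} {y\<in>T. w y = n}"
    using assms by (force simp: bij_betw_def inj_on_def)
  then show "gen_fun w T $ n = gen_fun v S $ n"
    by (simp add: gen_fun_nth bij_betw_same_card)
qed

lemma gen_fun_Un:
  assumes "S \<inter> T = {}" "\<And>n. finite {x\<in>S. w x = n}" "\<And>n. finite {x\<in>T. w x = n}"
  shows "gen_fun w (S \<union> T) = gen_fun w S + gen_fun w T"
proof (rule fps_ext)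
  fix n
  have "{x\<in>S \<union> T. w x = n} = {x\<in>S. w x = n} \<union> {x\<in>T. w x = n}" by auto
  moreover have "{x\<in>S. w x = n} \<inter> {x\<in>T. w x = n} = {}" using assms(1) by auto
  ultimately show "gen_fun w (S \<union> T) $ n = (gen_fun w S + gen_fun w T) $ n"
    using assms by (simp add: gen_fun_nth card_Un_disjoint)
qed

text \<open>The fibre over \<open>n\<close> splits according to the weight \<open>i\<close> of the
  first component, which is the Cauchy product.\<close>

lemma gen_fun_times:
  assumes "\<And>n. finite {x\<in>S. w x = n}" "\<And>n. finite {y\<in>T. v y = n}"
  shows "gen_fun (\<lambda>(x, y). w x + v y) (S \<times> T) = gen_fun w S * gen_fun v T"
proof (rule fps_ext)
  fix n
  let ?F = "\<lambda>i. {x\<in>S. w x = i} \<times> {y\<in>T. v y = n - i}"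
  have "{z\<in>S \<times> T. (\<lambda>(x, y). w x + v y) z = n} = (\<Union>i\<in>{0..n}. ?F i)" by auto
  moreover have "card (\<Union>i\<in>{0..n}. ?F i) = (\<Sum>i\<in>{0..n}. card (?F i))"
    using assms by (intro card_UN_disjoint) auto
  ultimately show "gen_fun (\<lambda>(x, y). w x + v y) (S \<times> T) $ n = (gen_fun w S * gen_fun v T) $ n"
    by (simp add: gen_fun_nth fps_mult_nth card_cartesian_product)
qed

lemma finite_fibre_times:
  assumes "\<And>n. finite {x\<in>S. w x = n}" "\<And>n. finite {y\<in>T. v y = n}"
  shows "finite {z\<in>S \<times> T. (\<lambda>(x, y). w x + v y) z = (n :: nat)}"
proof (rule finite_subset)
  show "{z\<in>S \<times> T. (\<lambda>(x, y). w x + v y) z = n} \<subseteq> (\<Union>i\<in>{0..n}. {x\<in>S. w x = i} \<times> {y\<in>T. v y = n - i})"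
    by auto
qed (use assms in auto)

section \<open>Lists of natural numbers, graded by their sum\<close>

abbreviation lists_of_length :: "nat \<Rightarrow> nat list set"
  where "lists_of_length m \<equiv> {l. length l = m}"

lemma finite_fibre_lists: "finite {l\<in>lists_of_length m. sum_list l = n}"
proof (rule finite_subset)
  show "{l\<in>lists_of_length m. sum_list l = n} \<subseteq> {l. set l \<subseteq> {..n} \<and> length l = m}"
    using member_le_sum_list by fastforce
qed (rule finite_lists_length_eq, simp)

text \<open>The series of a single number is geometric, and a list of length \<open>Suc m\<close> is
  a head together with a list of length \<open>m\<close>. Writing the identity as a product avoids
  division of power series over the integers.\<close>

lemma gen_fun_lists: "gen_fun sum_list (lists_of_length m) * (1 - fps_X) ^ m = 1"
proof (induction m)
  case 0
  have "{l\<in>lists_of_length 0. sum_list l = n} = (if n = 0 then {[]} else {})" for n by auto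
  then show ?case by (intro fps_ext) (simp add: gen_fun_nth)
next
  case (Suc m)
  have nat: "gen_fun (\<lambda>x. x) UNIV * (1 - fps_X) = 1"
  proof -
    have "gen_fun (\<lambda>x. x) UNIV = (Abs_fps (\<lambda>n. 1) :: int fps)"
      by (simp add: gen_fun_def)
    then show ?thesis
      by (intro fps_ext) (simp add: right_diff_distrib fps_mult_fps_X_commute[symmetric] del: fps_mult_fps_X_commute)
  qed
  have "bij_betw (\<lambda>(x, l). x # l) (UNIV \<times> lists_of_length m) (lists_of_length (Suc m))"
    by (rule bij_betwI[where g = "\<lambda>l. (hd l, tl l)"]) (auto simp: length_Suc_conv)
  then have "gen_fun sum_list (lists_of_length (Suc m)) = gen_fun (\<lambda>(x, l). x + sum_list l) (UNIV \<times> lists_of_length m)"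
    by (rule gen_fun_bij_betw) auto
  also have "\<dots> = gen_fun (\<lambda>x. x) UNIV * gen_fun sum_list (lists_of_length m)"
    using finite_fibre_lists by (intro gen_fun_times) auto
  finally show ?case using nat Suc.IH by (simp add: mult_ac)
qed

text \<open>Lowering every entry by 1 turns lists of positive numbers into arbitrary lists and
  lowers the sum by \<open>m\<close>.\<close>

lemma gen_fun_positive_lists:
  "gen_fun sum_list {l\<in>lists_of_length m. 0 \<notin> set l} = fps_X ^ m * gen_fun sum_list (lists_of_length m)"
proof (rule fps_ext)
  fix n
  have "bij_betw (map Suc) (lists_of_length m) {l\<in>lists_of_length m. 0 \<notin> set l}"
  proof (rule bij_betwI[where g = "map (\<lambda>x. x - 1)"])
    fix l :: "nat list" assume "l \<in> {l\<in>lists_of_length m. 0 \<notin> set l}"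
    then have "Suc (x - 1) = x" if "x \<in> set l" for x using that by (cases x) auto
    then show "map Suc (map (\<lambda>x. x - 1) l) = l" by (simp add: map_idI)
  qed (auto simp: o_def)
  then have "gen_fun sum_list {l\<in>lists_of_length m. 0 \<notin> set l} = gen_fun (\<lambda>l. sum_list l + m) (lists_of_length m)"
  proof (rule gen_fun_bij_betw)
    fix l :: "nat list" assume "l \<in> lists_of_length m"
    then show "sum_list (map Suc l) = sum_list l + m"
      by (induction l arbitrary: m) auto
  qed
  moreover have "gen_fun (\<lambda>l. sum_list l + m) (lists_of_length m) $ n = (fps_X ^ m * gen_fun sum_list (lists_of_length m)) $ n"
  proof (cases "n < m")
    case False
    then have "{l\<in>lists_of_length m. sum_list l + m = n} = {l\<in>lists_of_length m. sum_list l = n - m}" by auto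
    with False show ?thesis by (simp add: gen_fun_nth fps_X_power_mult_nth)
  qed (simp add: gen_fun_nth fps_X_power_mult_nth)
  ultimately show "gen_fun sum_list {l\<in>lists_of_length m. 0 \<notin> set l} $ n
    = (fps_X ^ m * gen_fun sum_list (lists_of_length m)) $ n" by simp
qed

lemma gen_fun_lists_containing_0:
  "gen_fun sum_list {l\<in>lists_of_length m. 0 \<in> set l} = (1 - fps_X ^ m) * gen_fun sum_list (lists_of_length m)"
proof -
  have "gen_fun sum_list ({l\<in>lists_of_length m. 0 \<notin> set l} \<union> {l\<in>lists_of_length m. 0 \<in> set l})
    = gen_fun sum_list {l\<in>lists_of_length m. 0 \<notin> set l} + gen_fun sum_list {l\<in>lists_of_length m. 0 \<in> set l}"
    by (intro gen_fun_Un finite_subset[OF _ finite_fibre_lists[of m]]) auto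
  also have "{l\<in>lists_of_length m. 0 \<notin> set l} \<union> {l\<in>lists_of_length m. 0 \<in> set l} = lists_of_length m" by auto
  finally have eq: "gen_fun sum_list (lists_of_length m)
    = fps_X ^ m * gen_fun sum_list (lists_of_length m) + gen_fun sum_list {l\<in>lists_of_length m. 0 \<in> set l}"
    unfolding gen_fun_positive_lists .
  show ?thesis
    unfolding left_diff_distrib mult_1_left eq_diff_eq by (subst (2) eq) (rule add.commute)
qed

text \<open>The choice of \<open>t\<close> multiplies the coefficient at \<open>n\<close> by
  \<open>n\<close>, so it acts on the series \<open>?L\<close> of lists as \<open>x d/dx\<close>.
  Differentiating \<open>?L * (1 - fps_X) ^ d = 1\<close> then gives the closed form.\<close>

lemma gen_fun_marked_lists:
  fixes d :: nat
  assumes "d \<ge> 1"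
  defines "C \<equiv> {(s, t). length s = d \<and> 1 \<le> t \<and> t \<le> sum_list s}"
  shows "gen_fun (\<lambda>(s, t). sum_list s) C * (1 - fps_X) ^ Suc d = of_nat d * fps_X"
    and "finite {z\<in>C. (\<lambda>(s, t). sum_list s) z = n}"
proof -
  let ?L = "gen_fun sum_list (lists_of_length d)"
  have fibre: "{z\<in>C. (\<lambda>(s, t). sum_list s) z = n} = {l\<in>lists_of_length d. sum_list l = n} \<times> {1..n}" for n
    by (auto simp: C_def)
  show "finite {z\<in>C. (\<lambda>(s, t). sum_list s) z = n}"
    unfolding fibre using finite_fibre_lists by blast
  have C: "gen_fun (\<lambda>(s, t). sum_list s) C = fps_X * fps_deriv ?L"
  proof (rule fps_ext)
    fix n
    show "gen_fun (\<lambda>(s, t). sum_list s) C $ n = (fps_X * fps_deriv ?L) $ n"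
      unfolding gen_fun_nth fibre by (cases n) (simp_all add: gen_fun_nth card_cartesian_product algebra_simps)
  qed
  have L: "?L * (1 - fps_X) ^ d = 1" by (rule gen_fun_lists)
  obtain m where m: "d = Suc m" using assms(1) by (cases d) auto
  have deriv_pow: "fps_deriv ((1 - fps_X) ^ d :: int fps) = - (of_nat d * (1 - fps_X) ^ m)"
    by (simp only: fps_deriv_power fps_of_nat) (simp add: m algebra_simps)
  have "fps_deriv (?L * (1 - fps_X) ^ d) = 0" unfolding L by simp
  then have "fps_deriv ?L * (1 - fps_X) ^ d = ?L * (of_nat d * (1 - fps_X) ^ m)"
    by (simp only: fps_deriv_mult deriv_pow) simp
  then have "fps_deriv ?L * (1 - fps_X) ^ d * (1 - fps_X) = ?L * (of_nat d * (1 - fps_X) ^ m) * (1 - fps_X)"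
    by (rule arg_cong)
  then have "fps_deriv ?L * (1 - fps_X) ^ Suc d = of_nat d * (?L * (1 - fps_X) ^ d)"
    by (simp only: m power_Suc mult_ac)
  then have "fps_deriv ?L * (1 - fps_X) ^ Suc d = of_nat d" unfolding L by simp
  then show "gen_fun (\<lambda>(s, t). sum_list s) C * (1 - fps_X) ^ Suc d = of_nat d * fps_X"
    unfolding C by (metis mult.assoc mult.commute)
qed

text \<open>
  These index the monomials of \<open>K[E]/I\<close> in the form described at \<open>theta\<close> below:
  modulo \<open>I\<close>, a product of an edge at \<open>X 2\<close> with all edges weighted by \<open>p\<close> can
  be replaced, so one of the two factors may be assumed absent.
\<close>

definition normal_forms :: "nat \<Rightarrow> nat \<Rightarrow> ((nat list \<times> nat) \<times> nat list \<times> nat list) set"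
  where "normal_forms k d = {((s, t), p, q). length s = d \<and> t \<le> sum_list s \<and> length p = k \<and> length q = k \<and>
    (t = 0 \<or> 0 \<in> set p)}"

definition weight :: "(nat list \<times> nat) \<times> nat list \<times> nat list \<Rightarrow> nat"
  where "weight = (\<lambda>((s, t), p, q). sum_list s + (sum_list p + sum_list q))"

definition h_poly :: "nat \<Rightarrow> nat \<Rightarrow> int poly"
  where "h_poly k d = 1 + of_nat d * (\<Sum>i\<in>{1..k}. monom 1 i)"

text \<open>The set splits into the part with \<open>t = 0\<close>, where \<open>p\<close> is
  arbitrary, and the part with \<open>t\<close> positive, where \<open>p\<close> must contain
  \<open>0\<close>. Both parts are Cartesian products.\<close>

lemma gen_fun_normal_forms:
  assumes "d \<ge> 1"
  shows "gen_fun weight (normal_forms k d) * (1 - fps_X) ^ (d + 2 * k) = fps_of_poly (h_poly k d)"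
proof -
  let ?L = "\<lambda>m. gen_fun sum_list (lists_of_length m)"
  let ?C0 = "{(s, t). length s = d \<and> t = (0 :: nat)}" and ?C1 = "{(s, t). length s = d \<and> 1 \<le> t \<and> t \<le> sum_list s}"
  let ?P0 = "lists_of_length k \<times> lists_of_length k"
    and ?P1 = "{p\<in>lists_of_length k. 0 \<in> set p} \<times> lists_of_length k"
  let ?w = "\<lambda>(s, t). sum_list s :: nat" and ?v = "\<lambda>(p, q). sum_list p + sum_list q :: nat"
  have weight_eq: "weight = (\<lambda>(c, p). ?w c + ?v p)"
    by (auto simp: weight_def fun_eq_iff)
  have fin_P: "finite {z\<in>?P0. ?v z = n}" "finite {z\<in>?P1. ?v z = n}" for n
    by (intro finite_fibre_times finite_fibre_lists finite_subset[OF _ finite_fibre_lists[of k]]; auto)+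
  have fin_C1: "finite {z\<in>?C1. ?w z = n}" for n by (rule gen_fun_marked_lists(2)[OF assms])
  have fin_C0: "finite {z\<in>?C0. ?w z = n}" for n
    by (rule finite_subset[of _ "{l\<in>lists_of_length d. sum_list l = n} \<times> {0}"])
      (use finite_fibre_lists in auto)
  have C0: "gen_fun ?w ?C0 = ?L d"
    by (rule gen_fun_bij_betw[where f = "\<lambda>s. (s, 0)"]) (auto simp: bij_betw_def inj_on_def)
  have P0: "gen_fun ?v ?P0 = ?L k * ?L k"
    by (intro gen_fun_times finite_fibre_lists)
  have P1: "gen_fun ?v ?P1 = (1 - fps_X ^ k) * ?L k * ?L k"
    unfolding gen_fun_lists_containing_0[symmetric]
    by (intro gen_fun_times finite_fibre_lists finite_subset[OF _ finite_fibre_lists[of k]]) auto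
  have "normal_forms k d = ?C0 \<times> ?P0 \<union> ?C1 \<times> ?P1"
    by (auto simp: normal_forms_def)
  then have "gen_fun weight (normal_forms k d) = gen_fun weight (?C0 \<times> ?P0) + gen_fun weight (?C1 \<times> ?P1)"
    unfolding weight_eq by (simp only:, intro gen_fun_Un finite_fibre_times fin_C0 fin_C1 fin_P) auto
  also have "gen_fun weight (?C0 \<times> ?P0) = ?L d * (?L k * ?L k)"
    unfolding weight_eq C0[symmetric] P0[symmetric] by (intro gen_fun_times fin_C0 fin_P)
  also have "gen_fun weight (?C1 \<times> ?P1) = gen_fun ?w ?C1 * ((1 - fps_X ^ k) * ?L k * ?L k)"
    unfolding weight_eq P1[symmetric] by (intro gen_fun_times fin_C1 fin_P)
  finally have eq: "gen_fun weight (normal_forms k d)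
    = ?L d * (?L k * ?L k) + gen_fun ?w ?C1 * ((1 - fps_X ^ k) * ?L k * ?L k)" .
  let ?o = "1 - fps_X :: int fps"
  have expand: "(a * (l * l) + g * (w * l * l)) * (y * z * z) * x
      = (a * y) * (l * z) * (l * z) * x + (g * (x * y)) * w * (l * z) * (l * z)"
    for a l g w x y z :: "int fps"
    by (simp add: algebra_simps)
  have pow: "?o ^ (d + 2 * k) = ?o ^ d * ?o ^ k * ?o ^ k"
    by (simp only: mult_2 power_add mult.assoc)
  \<comment> \<open>The second summand needs the exponent \<open>Suc d\<close>, so the identity is
    proved with one more factor \<open>1 - fps_X\<close>, which is cancelled at the end.\<close>
  have "gen_fun weight (normal_forms k d) * ?o ^ (d + 2 * k) * ?o
    = (?L d * ?o ^ d) * (?L k * ?o ^ k) * (?L k * ?o ^ k) * ?o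
      + (gen_fun ?w ?C1 * ?o ^ Suc d) * (1 - fps_X ^ k) * (?L k * ?o ^ k) * (?L k * ?o ^ k)"
    unfolding eq pow power_Suc by (rule expand)
  also have "\<dots> = ?o + of_nat d * fps_X * (1 - fps_X ^ k)"
    unfolding gen_fun_lists gen_fun_marked_lists(1)[OF assms] by simp
  also have "\<dots> = fps_of_poly (h_poly k d) * ?o"
  proof -
    have geo: "(\<Sum>i\<in>{1..k}. fps_X ^ i) * ?o = fps_X * (1 - fps_X ^ k)"
    proof (induction k)
      case (Suc k)
      have step: "(\<Sum>i\<in>{1..Suc k}. fps_X ^ i) * ?o = (\<Sum>i\<in>{1..k}. fps_X ^ i) * ?o + fps_X ^ Suc k * ?o"
        by (simp add: distrib_right)
      show ?case unfolding step Suc.IH by (simp add: algebra_simps)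
    qed simp
    have "fps_of_poly (h_poly k d) = 1 + of_nat d * (\<Sum>i\<in>{1..k}. fps_X ^ i)"
      by (simp add: h_poly_def fps_of_poly_simps fps_of_poly_sum fps_of_poly_monom')
        (simp add: of_nat_poly fps_of_poly_const fps_of_nat)
    then show ?thesis by (simp only: distrib_right mult.assoc geo mult_1_left)
  qed
  finally have "gen_fun weight (normal_forms k d) * ?o ^ (d + 2 * k) * ?o = fps_of_poly (h_poly k d) * ?o" .
  moreover have "?o \<noteq> 0"
    by (metis fps_X_neq_one right_minus_eq)
  ultimately show ?thesis by simp
qed

lemma degree_h_poly: "d \<ge> 1 \<Longrightarrow> k \<ge> 1 \<Longrightarrow> Polynomial.degree (h_poly k d) = k"
proof (rule antisym)
  have coeff: "Polynomial.coeff (h_poly k d) i = (if i = 0 then 1 else 0) + int d * (\<Sum>j\<in>{1..k}. if j = i then 1 else 0)" for i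
    unfolding h_poly_def by (simp add: coeff_sum of_nat_poly)
  show "Polynomial.degree (h_poly k d) \<le> k"
    by (rule degree_le) (auto simp: coeff)
  assume "d \<ge> 1" "k \<ge> 1"
  then show "k \<le> Polynomial.degree (h_poly k d)"
    by (intro le_degree) (auto simp: coeff)
qed

lemma poly_h_poly_1: "poly (h_poly k d) 1 = 1 + int d * int k"
  by (simp add: h_poly_def poly_sum poly_monom)

section \<open>The graphs \<open>G r d\<close>\<close>

text \<open>The residue modulo 3 records the constructor. The code makes \<open>vertex\<close> a
  linear order, as \<open>krull_dim_ge\<close> requires.\<close>

primrec vertex_code :: "vertex \<Rightarrow> nat"
  where "vertex_code (X i) = 3 * i" | "vertex_code (Y i) = 3 * i + 1" | "vertex_code (Z i) = 3 * i + 2"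

lemma vertex_code_inj: "vertex_code u = vertex_code v \<Longrightarrow> u = v"
  by (cases u; cases v; simp; presburger)

instantiation vertex :: linorder
begin

definition less_eq_vertex :: "vertex \<Rightarrow> vertex \<Rightarrow> bool"
  where "u \<le> v \<longleftrightarrow> vertex_code u \<le> vertex_code v"

definition less_vertex :: "vertex \<Rightarrow> vertex \<Rightarrow> bool"
  where "u < v \<longleftrightarrow> vertex_code u < vertex_code v"

instance
  by standard (auto simp: less_eq_vertex_def less_vertex_def intro: vertex_code_inj)

end

text \<open>Each edge meets \<open>U\<close> in one vertex, so interchanging the two sums counts
  every edge once. It is applied to the two sides of the bipartition.\<close>

lemma sum_vertex_degrees:
  assumes "finite F" "finite U" "Poly_Mapping.keys b \<subseteq> F"
    and "\<And>e. e \<in> F \<Longrightarrow> finite e" "\<And>e. e \<in> F \<Longrightarrow> card (e \<inter> U) = 1"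
  shows "(\<Sum>v\<in>U. Poly_Mapping.lookup (vertex_degrees b) v) = monomial_degree b"
proof -
  have "(\<Sum>v\<in>U. Poly_Mapping.lookup (vertex_degrees b) v)
    = (\<Sum>v\<in>U. \<Sum>e\<in>F. if v \<in> e then Poly_Mapping.lookup b e else 0)"
    by (intro sum.cong refl lookup_vertex_degrees assms)
  also have "\<dots> = (\<Sum>e\<in>F. \<Sum>v\<in>U. if v \<in> e then Poly_Mapping.lookup b e else 0)"
    by (rule sum.swap)
  also have "\<dots> = (\<Sum>e\<in>F. Poly_Mapping.lookup b e)"
  proof (intro sum.cong refl)
    fix e assume "e \<in> F"
    have "(\<Sum>v\<in>U. if v \<in> e then Poly_Mapping.lookup b e else 0) = (\<Sum>v\<in>e \<inter> U. Poly_Mapping.lookup b e)"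
      using assms(2) by (intro sum.mono_neutral_cong_right) auto
    then show "(\<Sum>v\<in>U. if v \<in> e then Poly_Mapping.lookup b e else 0) = Poly_Mapping.lookup b e"
      using assms(5)[OF \<open>e \<in> F\<close>] by simp
  qed
  also have "\<dots> = monomial_degree b"
    using monomial_degree_superset assms by metis
  finally show ?thesis .
qed

lemma sum_even_odd: "(\<Sum>i<2 * k. f i) = (\<Sum>i<k. f (2 * i)) + (\<Sum>i<k. f (2 * i + 1 :: nat))"
  for f :: "nat \<Rightarrow> nat"
  by (induction k) auto

text \<open>Greedy choice: the first entry takes as much of \<open>t\<close> as it can and the rest
  is passed on. This serves to spread \<open>t\<close> over the edges between \<open>X 2\<close> and
  the \<open>Y j\<close>.\<close>

lemma exists_bounded_list_with_sum:
  fixes s :: "nat list"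
  assumes "t \<le> sum_list s"
  shows "\<exists>b. length b = length s \<and> (\<forall>j<length s. b ! j \<le> s ! j) \<and> sum_list b = t"
  using assms
proof (induction s arbitrary: t)
  case (Cons x s)
  have "t - min x t \<le> sum_list s" using Cons.prems by auto
  then obtain b where b: "length b = length s" "\<forall>j<length s. b ! j \<le> s ! j" "sum_list b = t - min x t"
    using Cons.IH by blast
  show ?case
  proof (intro exI[of _ "min x t # b"] conjI allI impI)
    fix j assume "j < length (x # s)"
    then show "(min x t # b) ! j \<le> (x # s) ! j" using b by (cases j) auto
  qed (use b in auto)
qed auto

text \<open>Numbers the path from \<open>X 1\<close> at position \<open>0\<close> to
  \<open>X 2\<close> at position \<open>2 * k\<close>, where \<open>k\<close> stands for
  \<open>r - 1\<close>, so that the end edges need no separate treatment.\<close>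

definition path_vertex :: "nat \<Rightarrow> nat \<Rightarrow> vertex"
  where "path_vertex k i = (if i = 0 then X 1 else if i < 2 * k then Z i else X 2)"

abbreviation path_edge :: "nat \<Rightarrow> nat \<Rightarrow> vertex set"
  where "path_edge k i \<equiv> {path_vertex k i, path_vertex k (Suc i)}"

section \<open>The graph as a path together with the edges at the \<open>Y j\<close>\<close>

locale G_graph =
  fixes k d :: nat
  assumes k: "k \<ge> 2" and d: "d \<ge> 1"
begin

abbreviation "pv \<equiv> path_vertex k"
abbreviation "pe \<equiv> path_edge k"
abbreviation "V \<equiv> G_vertices (Suc k) d"
abbreviation "E \<equiv> G_edges (Suc k) d"

lemma pv_inj: "i \<le> 2 * k \<Longrightarrow> j \<le> 2 * k \<Longrightarrow> pv i = pv j \<longleftrightarrow> i = j"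
  using k by (auto simp: path_vertex_def split: if_splits)

lemma pv_neq_Y: "pv i \<noteq> Y j"
  by (simp add: path_vertex_def)

lemma V_eq: "V = pv ` {..2 * k} \<union> Y ` {1..d}"
proof -
  have "pv ` {..2 * k} = {X 1, X 2} \<union> Z ` {1..2 * k - 1}"
  proof (intro subset_antisym subsetI)
    fix v assume "v \<in> {X 1, X 2} \<union> Z ` {1..2 * k - 1}"
    then consider "v = pv 0" | "v = pv (2 * k)" | i where "i \<in> {1..2 * k - 1}" "v = pv i"
      using k by (auto simp: path_vertex_def)
    then show "v \<in> pv ` {..2 * k}" by cases auto
  qed (use k in \<open>auto simp: path_vertex_def\<close>)
  moreover have "X ` {1..2} = {X 1, X 2}"
    using atLeastAtMost_insertL[of "1::nat" 2] by (auto simp: atLeastAtMost_insertL[symmetric])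
  moreover have "2 * Suc k - 3 = 2 * k - 1" using k by simp
  ultimately show ?thesis unfolding G_vertices_def by auto
qed

text \<open>The \<open>Y\<close> vertices appear as \<open>Y (Suc j)\<close> with
  \<open>j < d\<close>, in agreement with the positions in the lists used below.\<close>

lemma E_eq: "E = (\<lambda>j. {X 1, Y (Suc j)}) ` {..<d} \<union> (\<lambda>j. {X 2, Y (Suc j)}) ` {..<d} \<union> pe ` {..<2 * k}"
proof -
  have "{{X i, Y j} |i j. 1 \<le> i \<and> i \<le> 2 \<and> 1 \<le> j \<and> j \<le> d}
    = (\<lambda>j. {X 1, Y j}) ` {Suc 0..d} \<union> (\<lambda>j. {X 2, Y j}) ` {Suc 0..d}"
  proof (intro subset_antisym subsetI)
    fix e assume "e \<in> {{X i, Y j} |i j. 1 \<le> i \<and> i \<le> 2 \<and> 1 \<le> j \<and> j \<le> d}"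
    then obtain i j where "e = {X i, Y j}" "1 \<le> i" "i \<le> 2" "1 \<le> j" "j \<le> d" by blast
    moreover from this have "i = 1 \<or> i = 2" by linarith
    ultimately show "e \<in> (\<lambda>j. {X 1, Y j}) ` {Suc 0..d} \<union> (\<lambda>j. {X 2, Y j}) ` {Suc 0..d}" by auto
  qed force
  also have "{Suc 0..d} = Suc ` {..<d}" by (auto simp: image_Suc_lessThan)
  finally have XY: "{{X i, Y j} |i j. 1 \<le> i \<and> i \<le> 2 \<and> 1 \<le> j \<and> j \<le> d}
    = (\<lambda>j. {X 1, Y (Suc j)}) ` {..<d} \<union> (\<lambda>j. {X 2, Y (Suc j)}) ` {..<d}"
    by (simp add: image_image)
  have idx: "2 * Suc k - 4 = 2 * k - 2" "2 * Suc k - 3 = 2 * k - 1" using k by auto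
  have "{..<2 * k} = {0} \<union> {1..2 * k - 2} \<union> {2 * k - 1}" using k by auto
  then have "pe ` {..<2 * k} = {pe 0} \<union> pe ` {1..2 * k - 2} \<union> {pe (2 * k - 1)}" by auto
  also have "pe 0 = {X 1, Z 1}" using k by (simp add: path_vertex_def)
  also have "pe (2 * k - 1) = {Z (2 * k - 1), X 2}" using k by (simp add: path_vertex_def)
  also have "pe ` {1..2 * k - 2} = (\<lambda>i. {Z i, Z (i + 1)}) ` {1..2 * k - 2}"
    using k by (intro image_cong) (auto simp: path_vertex_def)
  also have "\<dots> = {{Z i, Z (i + 1)} |i. 1 \<le> i \<and> i \<le> 2 * k - 2}" by auto
  finally have P: "pe ` {..<2 * k} = {{X 1, Z 1}} \<union> {{Z i, Z (i + 1)} |i. 1 \<le> i \<and> i \<le> 2 * k - 2} \<union> {{Z (2 * k - 1), X 2}}" .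
  show ?thesis unfolding G_edges_def XY P idx by (simp only: Un_assoc)
qed

lemma finite_E: "finite E" and E_cases: "e \<in> E \<Longrightarrow> e \<subseteq> V \<and> finite e"
proof -
  show "finite E" unfolding E_eq by simp
  show "e \<subseteq> V \<and> finite e" if "e \<in> E"
  proof -
    have "X 1 = pv 0" "X 2 = pv (2 * k)" using k by (auto simp: path_vertex_def)
    then show ?thesis using that unfolding E_eq V_eq by auto
  qed
qed

lemma pe_inj: "inj_on pe {..<2 * k}"
proof (rule inj_onI)
  fix i j assume "i \<in> {..<2 * k}" "j \<in> {..<2 * k}" "pe i = pe j"
  then show "i = j"
    using pv_inj[of i j] pv_inj[of "Suc i" "Suc j"] pv_inj[of i "Suc j"] pv_inj[of "Suc i" j]
    by (auto simp: doubleton_eq_iff)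
qed

lemma sum_E: "(\<Sum>e\<in>E. f e) = (\<Sum>j<d. f {X 1, Y (Suc j)}) + (\<Sum>j<d. f {X 2, Y (Suc j)}) + (\<Sum>i<2 * k. f (pe i))"
  for f :: "vertex set \<Rightarrow> nat"
proof -
  have i1: "inj_on (\<lambda>j. {X 1, Y (Suc j)}) {..<d}" and i2: "inj_on (\<lambda>j. {X 2, Y (Suc j)}) {..<d}"
    by (auto simp: inj_on_def doubleton_eq_iff)
  let ?E1 = "(\<lambda>j. {X 1, Y (Suc j)}) ` {..<d}" and ?E2 = "(\<lambda>j. {X 2, Y (Suc j)}) ` {..<d}"
    and ?E3 = "pe ` {..<2 * k}"
  have "{X 1, Y i} \<noteq> {X 2, Y j}" for i j by (simp add: doubleton_eq_iff)
  then have "?E1 \<inter> ?E2 = {}" by blast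
  moreover have "Y j \<notin> pe i" for i j using pv_neq_Y[symmetric] by simp
  then have "(?E1 \<union> ?E2) \<inter> ?E3 = {}" by blast
  ultimately have "sum f (?E1 \<union> ?E2 \<union> ?E3) = sum f ?E1 + sum f ?E2 + sum f ?E3"
    by (simp add: sum.union_disjoint)
  then show ?thesis
    unfolding E_eq sum.reindex[OF i1] sum.reindex[OF i2] sum.reindex[OF pe_inj] o_def .
qed

text \<open>
  The vertex degrees of a monomial in which \<open>s\<close> lists the degrees at the vertices \<open>Y j\<close>,
  \<open>t\<close> is the total weight of the edges between \<open>X 2\<close> and the \<open>Y j\<close>, and the
  edges of the path carry alternately the weights in \<open>p\<close> and in \<open>q\<close>, starting at
  \<open>X 1\<close>.
\<close>

definition theta :: "(nat list \<times> nat) \<times> nat list \<times> nat list \<Rightarrow> vertex \<Rightarrow> nat"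
  where "theta = (\<lambda>((s, t), p, q) v.
    let w = (\<lambda>i. if even i then p ! (i div 2) else q ! (i div 2)) in
    case v of
      X i \<Rightarrow> (if i = 1 then sum_list s - t + w 0 else if i = 2 then t + w (2 * k - 1) else 0)
    | Y j \<Rightarrow> (if 1 \<le> j \<and> j \<le> d then s ! (j - 1) else 0)
    | Z i \<Rightarrow> (if 1 \<le> i \<and> i < 2 * k then w (i - 1) + w i else 0))"

lemma theta_simps:
  fixes p q
  defines "w \<equiv> (\<lambda>i. if even i then p ! (i div 2) else q ! (i div 2))"
  shows "theta ((s, t), p, q) (X i) = (if i = 1 then sum_list s - t + w 0 else if i = 2 then t + w (2 * k - 1) else 0)"
    and "theta ((s, t), p, q) (Y j) = (if 1 \<le> j \<and> j \<le> d then s ! (j - 1) else 0)"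
    and "theta ((s, t), p, q) (Z i) = (if 1 \<le> i \<and> i < 2 * k then w (i - 1) + w i else 0)"
  by (simp_all add: theta_def w_def Let_def)

text \<open>The hypotheses are equations between \<open>b\<close> and the parameters, so that the
  lemma serves both for parameters read off a given \<open>b\<close> and for a \<open>b\<close>
  built from given parameters.\<close>

lemma vertex_degrees_eq_theta:
  assumes keys: "Poly_Mapping.keys b \<subseteq> E"
    and len: "length s = d" "length p = k" "length q = k"
    and s: "\<And>j. j < d \<Longrightarrow> s ! j = Poly_Mapping.lookup b {X 1, Y (Suc j)} + Poly_Mapping.lookup b {X 2, Y (Suc j)}"
    and t: "t = (\<Sum>j<d. Poly_Mapping.lookup b {X 2, Y (Suc j)})"
    and w: "\<And>i. i < 2 * k \<Longrightarrow> Poly_Mapping.lookup b (pe i) = (if even i then p ! (i div 2) else q ! (i div 2))"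
  shows "Poly_Mapping.lookup (vertex_degrees b) = theta ((s, t), p, q)"
    and "monomial_degree b = weight ((s, t), p, q)"
proof -
  let ?l = "Poly_Mapping.lookup b"
  define w where "w i = (if even i then p ! (i div 2) else q ! (i div 2))" for i
  have w': "i < 2 * k \<Longrightarrow> ?l (pe i) = w i" for i using w by (simp add: w_def)
  have sum_s: "sum_list s = (\<Sum>j<d. ?l {X 1, Y (Suc j)}) + (\<Sum>j<d. ?l {X 2, Y (Suc j)})"
    using s len by (simp add: sum_list_sum_nth sum.distrib atLeast0LessThan)
  have sum_pq: "(\<Sum>i<2 * k. w i) = sum_list p + sum_list q"
    using len by (simp add: sum_even_odd w_def sum_list_sum_nth atLeast0LessThan)
  show "monomial_degree b = weight ((s, t), p, q)"
    unfolding monomial_degree_superset[OF finite_E keys] sum_E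
    using sum_s sum_pq w' by (simp add: weight_def)
  have deg: "Poly_Mapping.lookup (vertex_degrees b) v
    = (\<Sum>j<d. if v \<in> {X 1, Y (Suc j)} then ?l {X 1, Y (Suc j)} else 0)
    + (\<Sum>j<d. if v \<in> {X 2, Y (Suc j)} then ?l {X 2, Y (Suc j)} else 0)
    + (\<Sum>i<2 * k. if v \<in> pe i then w i else 0)" for v
  proof -
    have "Poly_Mapping.lookup (vertex_degrees b) v = (\<Sum>e\<in>E. if v \<in> e then ?l e else 0)"
      by (rule lookup_vertex_degrees[OF finite_E keys]) (use E_cases in blast)
    moreover have "(\<Sum>i<2 * k. if v \<in> pe i then ?l (pe i) else 0) = (\<Sum>i<2 * k. if v \<in> pe i then w i else 0)"
      using w' by (intro sum.cong) auto
    ultimately show ?thesis unfolding sum_E by (simp only:)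
  qed
  have outside: "Poly_Mapping.lookup (vertex_degrees b) v = 0" if "v \<notin> V" for v
  proof -
    have "v \<notin> Poly_Mapping.keys (vertex_degrees b)"
      using that keys_vertex_degrees[of b] keys E_cases by blast
    then show ?thesis by (simp add: in_keys_iff)
  qed
  \<comment> \<open>The vertex \<open>pv m\<close> lies on the path edges numbered
    \<open>m - 1\<close> and \<open>m\<close>; each end of the path lacks one of them.\<close>
  have path_part: "(\<Sum>i<2 * k. if pv m \<in> pe i then w i else 0)
    = (if m = 0 then 0 else w (m - 1)) + (if m = 2 * k then 0 else w m)" if m: "m \<le> 2 * k" for m
  proof -
    have "(\<Sum>i<2 * k. if pv m \<in> pe i then w i else 0) = (\<Sum>i<2 * k. (if Suc i = m then w i else 0) + (if i = m then w i else 0))"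
      using m by (intro sum.cong) (auto simp: pv_inj)
    also have "\<dots> = (\<Sum>i<2 * k. if Suc i = m then w i else 0) + (\<Sum>i<2 * k. if i = m then w i else 0)"
      by (rule sum.distrib)
    also have "(\<Sum>i<2 * k. if Suc i = m then w i else 0) = (if m = 0 then 0 else w (m - 1))"
      using m by (cases m) auto
    also have "(\<Sum>i<2 * k. if i = m then w i else 0) = (if m = 2 * k then 0 else w m)"
      using m by auto
    finally show ?thesis .
  qed
  show "Poly_Mapping.lookup (vertex_degrees b) = theta ((s, t), p, q)"
  proof
    fix v
    show "Poly_Mapping.lookup (vertex_degrees b) v = theta ((s, t), p, q) v"
    proof (cases v)
      case (X i)
      have "v = pv 0" if "i = 1" using X that by (simp add: path_vertex_def)
      moreover have "v = pv (2 * k)" if "i = 2" using X that k by (simp add: path_vertex_def)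
      moreover have "v \<notin> V" if "i \<noteq> 1" "i \<noteq> 2"
        using that X unfolding V_eq by (auto simp: path_vertex_def split: if_splits)
      ultimately show ?thesis
        using outside[of v] path_part[of 0] path_part[of "2 * k"] k
        by (auto simp: X theta_simps w_def deg sum_s t)
    next
      case (Y j)
      show ?thesis
      proof (cases "1 \<le> j \<and> j \<le> d")
        case True
        then obtain j' where j': "j = Suc j'" "j' < d" by (cases j) auto
        then have "Poly_Mapping.lookup (vertex_degrees b) v = ?l {X 1, Y j} + ?l {X 2, Y j}"
          unfolding deg Y using pv_neq_Y[symmetric, of j] by simp
        then show ?thesis using j' s by (simp add: Y theta_simps)
      next
        case False
        then have "v \<notin> V" unfolding V_eq Y using pv_neq_Y by (metis Un_iff atLeastAtMost_iff imageE vertex.inject(2))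
        then show ?thesis using outside False by (auto simp: Y theta_simps)
      qed
    next
      case (Z i)
      show ?thesis
      proof (cases "1 \<le> i \<and> i < 2 * k")
        case True
        then have pv_i: "pv i = Z i" by (simp add: path_vertex_def)
        have "Poly_Mapping.lookup (vertex_degrees b) v = w (i - 1) + w i"
          using True path_part[of i] unfolding pv_i deg Z by simp
        then show ?thesis using True by (simp only: Z theta_simps w_def simp_thms if_True)
      next
        case False
        then have "v \<notin> V" unfolding V_eq Z by (auto simp: path_vertex_def split: if_splits)
        then show ?thesis using outside False by (auto simp: Z theta_simps)
      qed
    qed
  qed
qed

section \<open>Degree vectors and their normal forms\<close>

definition all_forms :: "((nat list \<times> nat) \<times> nat list \<times> nat list) set"
  where "all_forms = {((s, t), p, q). length s = d \<and> t \<le> sum_list s \<and> length p = k \<and> length q = k}"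

text \<open>In one direction the parameters are read off a monomial. In the other, \<open>t\<close>
  has to be spread over the single edges at \<open>X 2\<close>; any choice bounded by
  \<open>s\<close> will do, which reflects the binomials of the 4-cycles.\<close>

lemma vertex_degrees_image:
  "Poly_Mapping.lookup ` vertex_degrees ` monomials E n = theta ` {z\<in>all_forms. weight z = n}"
proof (intro subset_antisym subsetI)
  fix f assume "f \<in> Poly_Mapping.lookup ` vertex_degrees ` monomials E n"
  then obtain b where b: "Poly_Mapping.keys b \<subseteq> E" "monomial_degree b = n" "f = Poly_Mapping.lookup (vertex_degrees b)"
    by (auto simp: monomials_def)
  let ?l = "Poly_Mapping.lookup b"
  let ?s = "map (\<lambda>j. ?l {X 1, Y (Suc j)} + ?l {X 2, Y (Suc j)}) [0..<d]"
    and ?t = "\<Sum>j<d. ?l {X 2, Y (Suc j)}"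
    and ?p = "map (\<lambda>i. ?l (pe (2 * i))) [0..<k]" and ?q = "map (\<lambda>i. ?l (pe (2 * i + 1))) [0..<k]"
  have w: "?l (pe i) = (if even i then ?p ! (i div 2) else ?q ! (i div 2))" if "i < 2 * k" for i
  proof -
    have "i div 2 < k" using that by auto
    moreover have "even i \<Longrightarrow> 2 * (i div 2) = i" "odd i \<Longrightarrow> 2 * (i div 2) + 1 = i" by auto
    ultimately show ?thesis by auto
  qed
  have "f = theta ((?s, ?t), ?p, ?q)" "n = weight ((?s, ?t), ?p, ?q)"
    using vertex_degrees_eq_theta[OF b(1), of ?s ?p ?q ?t, OF _ _ _ _ _ w] b(2,3) by simp_all
  moreover have "((?s, ?t), ?p, ?q) \<in> all_forms"
    unfolding all_forms_def
    by (simp add: sum_list_sum_nth sum.distrib atLeast0LessThan)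
  ultimately show "f \<in> theta ` {z\<in>all_forms. weight z = n}" by blast
next
  fix f assume "f \<in> theta ` {z\<in>all_forms. weight z = n}"
  then obtain s t p q where z: "length s = d" "t \<le> sum_list s" "length p = k" "length q = k"
    "weight ((s, t), p, q) = n" "f = theta ((s, t), p, q)"
    by (auto simp: all_forms_def)
  obtain c where c: "length c = d" "\<And>j. j < d \<Longrightarrow> c ! j \<le> s ! j" "sum_list c = t"
    using exists_bounded_list_with_sum[OF z(2)] z(1) by auto
  define w where "w i = (if even i then p ! (i div 2) else q ! (i div 2))" for i
  \<comment> \<open>At \<open>Y (Suc j)\<close> the degree \<open>s ! j\<close> is split into
    \<open>c ! j\<close> on the edge to \<open>X 2\<close> and the remainder on the edge to
    \<open>X 1\<close>.\<close>
  define b :: "vertex set \<Rightarrow>\<^sub>0 nat" where "b = (\<Sum>j<d. Poly_Mapping.single {X 1, Y (Suc j)} (s ! j - c ! j))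
    + (\<Sum>j<d. Poly_Mapping.single {X 2, Y (Suc j)} (c ! j)) + (\<Sum>i<2 * k. Poly_Mapping.single (pe i) (w i))"
  have lookup_b: "Poly_Mapping.lookup b e = (\<Sum>j<d. if {X 1, Y (Suc j)} = e then s ! j - c ! j else 0)
    + (\<Sum>j<d. if {X 2, Y (Suc j)} = e then c ! j else 0) + (\<Sum>i<2 * k. if pe i = e then w i else 0)" for e
    unfolding b_def lookup_add lookup_sum lookup_single when_def ..
  have pe_neq: "pe i \<noteq> {x, Y j}" for i x j
    using pv_neq_Y by (metis insert_iff singletonD)
  have "Poly_Mapping.lookup b e = 0" if "e \<notin> E" for e
    using that unfolding lookup_b E_eq by (auto intro!: sum.neutral)
  then have keys: "Poly_Mapping.keys b \<subseteq> E" by (auto simp: in_keys_iff)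
  have b1: "Poly_Mapping.lookup b {X 1, Y (Suc j)} = s ! j - c ! j" if "j < d" for j
    unfolding lookup_b using that pe_neq by (auto simp: doubleton_eq_iff[of _ "Y _"])
  have b2: "Poly_Mapping.lookup b {X 2, Y (Suc j)} = c ! j" if "j < d" for j
    unfolding lookup_b using that pe_neq by (auto simp: doubleton_eq_iff[of _ "Y _"])
  have b3: "Poly_Mapping.lookup b (pe i) = w i" if "i < 2 * k" for i
  proof -
    have "(\<Sum>i'<2 * k. if pe i' = pe i then w i' else 0) = (\<Sum>i'<2 * k. if i' = i then w i' else 0)"
    proof (intro sum.cong refl)
      fix i' assume "i' \<in> {..<2 * k}"
      then have "pe i' = pe i \<longleftrightarrow> i' = i" using that by (intro inj_on_eq_iff[OF pe_inj]) auto
      then show "(if pe i' = pe i then w i' else 0) = (if i' = i then w i' else 0)" by (simp only:)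
    qed
    then show ?thesis
      unfolding lookup_b using that pe_neq[symmetric] by simp
  qed
  have "Poly_Mapping.lookup (vertex_degrees b) = f" "monomial_degree b = n"
    using vertex_degrees_eq_theta[OF keys, of s p q t] z b1 b2 b3 c
    by (simp_all add: w_def sum_list_sum_nth atLeast0LessThan)
  then show "f \<in> Poly_Mapping.lookup ` vertex_degrees ` monomials E n"
    using keys by (auto simp: monomials_def)
qed

text \<open>Induction on \<open>t\<close>: while \<open>t\<close> is positive and \<open>p\<close>
  has no zero entry, lowering \<open>t\<close> and all of \<open>p\<close> by 1 and raising all of
  \<open>q\<close> by 1 preserves \<open>theta\<close> and, since \<open>p\<close> and
  \<open>q\<close> have equal length, also the weight.\<close>

lemma theta_all_forms:
  "theta ` {z\<in>all_forms. weight z = n} = theta ` {z\<in>normal_forms k d. weight z = n}"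
proof (intro subset_antisym subsetI)
  have "theta ((s, t), p, q) \<in> theta ` {z\<in>normal_forms k d. weight z = n}"
    if "((s, t), p, q) \<in> all_forms" "weight ((s, t), p, q) = n" for s t p q
    using that
  proof (induction t arbitrary: p q)
    case 0
    then show ?case by (intro imageI) (auto simp: all_forms_def normal_forms_def)
  next
    case (Suc t)
    show ?case
    \<comment> \<open>One application of the binomial of the even cycle through the path lowers \<open>t\<close>, provided
      that every edge weighted by \<open>p\<close> has positive weight.\<close>
    proof (cases "0 \<in> set p")
      case True
      with Suc.prems show ?thesis by (intro imageI) (auto simp: all_forms_def normal_forms_def)
    next
      case False
      have len: "length s = d" "length p = k" "length q = k" "Suc t \<le> sum_list s"
        using Suc.prems by (auto simp: all_forms_def)
      define p' where "p' = map (\<lambda>x. x - 1) p"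
      define q' where "q' = map Suc q"
      have p_pos: "p ! i \<ge> 1" if "i < k" for i
        using False that len nth_mem[of i p] by (cases "p ! i") auto
      have p_eq: "p = map Suc p'"
      proof (rule nth_equalityI)
        fix i assume "i < length p"
        then show "p ! i = map Suc p' ! i" using p_pos[of i] len by (simp add: p'_def)
      qed (simp add: p'_def)
      have sums: "sum_list (map Suc l) = sum_list l + length l" for l :: "nat list"
        by (induction l) auto
      have "((s, t), p', q') \<in> all_forms" using len by (auto simp: all_forms_def p'_def q'_def)
      moreover have "weight ((s, t), p', q') = n"
        using Suc.prems(2) len unfolding p_eq q'_def by (simp add: weight_def sums)
      ultimately have "theta ((s, t), p', q') \<in> theta ` {z\<in>normal_forms k d. weight z = n}"
        by (rule Suc.IH)
      moreover have "theta ((s, t), p', q') = theta ((s, Suc t), p, q)"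
      proof
        fix v
        have p': "i < k \<Longrightarrow> p ! i = Suc (p' ! i)" for i unfolding p_eq using len by (simp add: p'_def)
        have q': "i < k \<Longrightarrow> q' ! i = Suc (q ! i)" for i using len by (simp add: q'_def)
        have half: "(2 * k - 1) div 2 = k - 1" "odd (2 * k - 1)" using k by auto
        show "theta ((s, t), p', q') v = theta ((s, Suc t), p, q) v"
        proof (cases v)
          case (X i)
          then show ?thesis using len p'[of 0] q'[of "k - 1"] k half by (auto simp: theta_simps)
        next
          case (Z i)
          show ?thesis
          proof (cases "1 \<le> i \<and> i < 2 * k")
            case True
            then have "i div 2 < k" "(i - 1) div 2 < k" "even (i - 1) \<longleftrightarrow> odd i" by auto
            then show ?thesis using True p' q' by (auto simp: Z theta_simps)
          qed (auto simp: Z theta_simps)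
        qed (simp add: theta_simps)
      qed
      ultimately show ?thesis by simp
    qed
  qed
  then show "f \<in> theta ` {z\<in>normal_forms k d. weight z = n}" if "f \<in> theta ` {z\<in>all_forms. weight z = n}" for f
    using that by (auto simp: all_forms_def)
qed (auto simp: normal_forms_def all_forms_def)

text \<open>Equality at \<open>X 1\<close> compares the first path weights, and equality at each
  \<open>Z i\<close> makes the differences alternate in sign along the path. If
  \<open>t > t'\<close>, then \<open>p\<close> has an entry \<open>0\<close>, whereas the difference
  at that even position would be positive.\<close>

lemma theta_eq_imp:
  assumes eq: "theta ((s, t), p, q) = theta ((s', t'), p', q')"
    and nf: "((s, t), p, q) \<in> normal_forms k d" "((s', t'), p', q') \<in> normal_forms k d"
  defines "w \<equiv> \<lambda>i. int (if even i then p ! (i div 2) else q ! (i div 2))"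
    and "w' \<equiv> \<lambda>i. int (if even i then p' ! (i div 2) else q' ! (i div 2))"
  shows "s = s'" and "i < 2 * k \<Longrightarrow> w i - w' i = (- 1) ^ i * (int t - int t')" and "t \<le> t'"
proof -
  have len: "length s = d" "length p = k" "length q = k" "length s' = d" "length p' = k" "length q' = k"
    "t \<le> sum_list s" "t' \<le> sum_list s'"
    using nf by (auto simp: normal_forms_def)
  show s: "s = s'"
  proof (rule nth_equalityI)
    fix j assume "j < length s"
    then show "s ! j = s' ! j" using fun_cong[OF eq, of "Y (Suc j)"] len by (simp add: theta_simps)
  qed (use len in simp)
  have base: "w 0 - w' 0 = int t - int t'"
    using fun_cong[OF eq, of "X 1"] len by (simp add: theta_simps w_def w'_def s)
  \<comment> \<open>Versions of \<open>w\<close> and \<open>w'\<close> in the natural numbers, where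
    the equations given by \<open>theta\<close> live.\<close>
  define u where "u i = (if even i then p ! (i div 2) else q ! (i div 2))" for i
  define u' where "u' i = (if even i then p' ! (i div 2) else q' ! (i div 2))" for i
  have w_u: "w i = int (u i)" "w' i = int (u' i)" for i by (simp_all add: w_def w'_def u_def u'_def)
  have w: "w i - w' i = (- 1) ^ i * (int t - int t')" if "i < 2 * k" for i
    using that
  proof (induction i)
    case (Suc i)
    have "w i + w (Suc i) = w' i + w' (Suc i)"
    proof -
      have "u i + u (Suc i) = u' i + u' (Suc i)"
        using fun_cong[OF eq, of "Z (Suc i)"] Suc.prems
        by (cases "even i") (simp_all add: theta_simps u_def u'_def)
      then show ?thesis by (simp only: w_u flip: of_nat_add)
    qed
    then have "w (Suc i) - w' (Suc i) = - (w i - w' i)" by simp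
    also have "\<dots> = (- 1) ^ Suc i * (int t - int t')" using Suc by simp
    finally show ?case .
  qed (simp add: base)
  then show "i < 2 * k \<Longrightarrow> w i - w' i = (- 1) ^ i * (int t - int t')" .
  show "t \<le> t'"
  proof (rule ccontr)
    assume "\<not> t \<le> t'"
    then have "0 \<in> set p" using nf(1) by (auto simp: normal_forms_def)
    then obtain i where i: "i < k" "p ! i = 0" using len by (metis in_set_conv_nth)
    then show False using w[of "2 * i"] \<open>\<not> t \<le> t'\<close> by (simp add: w_def w'_def)
  qed
qed

text \<open>The inequality in \<open>theta_eq_imp\<close>, used in both directions, gives
  \<open>t = t'\<close>; then all differences of path weights vanish.\<close>

lemma theta_inj: "inj_on theta (normal_forms k d)"
proof (rule inj_onI)
  fix z z' assume z: "z \<in> normal_forms k d" "z' \<in> normal_forms k d" "theta z = theta z'"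
  obtain s t p q s' t' p' q' where zz: "z = ((s, t), p, q)" "z' = ((s', t'), p', q')"
    by (metis prod.exhaust)
  note imp = theta_eq_imp[OF z(3)[unfolded zz] z(1,2)[unfolded zz]]
  have "t' \<le> t" using theta_eq_imp(3)[OF z(3)[unfolded zz, symmetric]] z zz by simp
  with imp(3) have t: "t = t'" by simp
  have len: "length p = k" "length q = k" "length p' = k" "length q' = k"
    using z zz by (auto simp: normal_forms_def)
  have "p ! i = p' ! i" "q ! i = q' ! i" if "i < k" for i
    using imp(2)[of "2 * i"] imp(2)[of "2 * i + 1"] that t by simp_all
  then have "p = p'" "q = q'" using len by (auto intro: nth_equalityI)
  then show "z = z'" using imp(1) t zz by simp
qed

lemma card_vertex_degrees: "int (card (vertex_degrees ` monomials E n)) = gen_fun weight (normal_forms k d) $ n"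
proof -
  have "card (vertex_degrees ` monomials E n) = card (Poly_Mapping.lookup ` vertex_degrees ` monomials E n)"
    by (rule card_image[symmetric], rule inj_onI) (simp only: poly_mapping_eq_iff)
  also have "\<dots> = card {z\<in>normal_forms k d. weight z = n}"
    unfolding vertex_degrees_image theta_all_forms
    using theta_inj by (intro card_image) (auto intro: inj_on_subset)
  finally show ?thesis by (simp add: gen_fun_nth)
qed

end

section \<open>Hilbert series and Krull dimension of the toric ring\<close>

locale G_toric = G_graph +
  fixes A :: "(vertex set, 'k::field) mpoly set graded_algebra"
  assumes A: "A = toric_ring (G_vertices (Suc k) d) (G_edges (Suc k) d)"
begin

sublocale toric_graph V E A
  using finite_E E_cases A by unfold_locales auto

lemma hilbert_series_eq: "hilbert_series A * (1 - fps_X) ^ (d + 2 * k) = fps_of_poly (h_poly k d)"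
proof -
  have "hilbert_series A = gen_fun weight (normal_forms k d)"
    by (rule fps_ext) (simp add: hilbert_series_def hilbert_function_toric_ring card_vertex_degrees)
  then show ?thesis using gen_fun_normal_forms[OF d, of k] by simp
qed

lemma krull_dim_A: "krull_dim A = enat (d + 2 * k)"
proof (rule antisym)
  \<comment> \<open>The bipartition by parity of the position on the path: as \<open>2 * k\<close>
    is even, \<open>X 1\<close> and \<open>X 2\<close> lie on one side and the \<open>Y j\<close> on
    the other.\<close>
  let ?U1 = "pv ` {i. i \<le> 2 * k \<and> even i}" and ?U2 = "pv ` {i. i \<le> 2 * k \<and> odd i} \<union> Y ` {1..d}"
  have X12: "X 1 = pv 0" "X 2 = pv (2 * k)" using k by (auto simp: path_vertex_def)
  have fin: "finite ?U1" "finite ?U2" by auto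
  have "finite V" unfolding V_eq by simp
  have X2_V: "X 2 \<in> V" "X 2 \<in> ?U1" "X 2 \<notin> ?U2" unfolding V_eq X12 by (auto simp: pv_inj pv_neq_Y)
  have card_V: "card V = d + 2 * k + 1"
  proof -
    have "inj_on pv {..2 * k}" by (auto simp: inj_on_def pv_inj)
    then show ?thesis unfolding V_eq
      by (subst card_Un_disjoint) (auto simp: card_image inj_on_def pv_neq_Y)
  qed
  have Un: "?U1 \<union> ?U2 = V" unfolding V_eq by auto
  have split: "card (e \<inter> ?U1) = 1 \<and> card (e \<inter> ?U2) = 1" if e: "e \<in> E" for e
  proof -
    have pv_U1: "pv i \<in> ?U1 \<longleftrightarrow> even i" and pv_U2: "pv i \<in> ?U2 \<longleftrightarrow> odd i" if "i \<le> 2 * k" for i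
      using that by (auto simp: pv_inj pv_neq_Y)
    have Y_U1: "Y j \<notin> ?U1" for j using pv_neq_Y by (metis imageE)
    consider j where "j < d" "e = {pv 0, Y (Suc j)}" | j where "j < d" "e = {pv (2 * k), Y (Suc j)}"
      | i where "i < 2 * k" "e = pe i"
      using e unfolding E_eq X12 by blast
    then show ?thesis
    proof cases
      case 1
      then have "e \<inter> ?U1 = {pv 0}" "e \<inter> ?U2 = {Y (Suc j)}"
        using Y_U1 pv_U1[of 0] pv_U2[of 0] by auto
      then show ?thesis by simp
    next
      case 2
      then have "e \<inter> ?U1 = {pv (2 * k)}" "e \<inter> ?U2 = {Y (Suc j)}"
        using Y_U1 pv_U1[of "2 * k"] pv_U2[of "2 * k"] by auto
      then show ?thesis by simp
    next
      case 3
      then have "if even i then e \<inter> ?U1 = {pv i} \<and> e \<inter> ?U2 = {pv (Suc i)}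
        else e \<inter> ?U1 = {pv (Suc i)} \<and> e \<inter> ?U2 = {pv i}"
        using pv_U1[of i] pv_U2[of i] pv_U1[of "Suc i"] pv_U2[of "Suc i"] by (auto simp del: Un_iff)
      then show ?thesis by (auto split: if_splits)
    qed
  qed
  have "krull_dim A \<le> enat (card (V - {X 2}))"
  proof (rule krull_dim_le)
    fix a b assume ab: "Poly_Mapping.keys a \<subseteq> E" "Poly_Mapping.keys b \<subseteq> E"
      and agree: "\<And>v. v \<in> V - {X 2} \<Longrightarrow> Poly_Mapping.lookup (vertex_degrees a) v = Poly_Mapping.lookup (vertex_degrees b) v"
    let ?a = "Poly_Mapping.lookup (vertex_degrees a)" and ?b = "Poly_Mapping.lookup (vertex_degrees b)"
    have sums: "(\<Sum>v\<in>U. Poly_Mapping.lookup (vertex_degrees c) v) = monomial_degree c"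
      if "finite U" "Poly_Mapping.keys c \<subseteq> E" "\<And>e. e \<in> E \<Longrightarrow> card (e \<inter> U) = 1" for U c
      by (rule sum_vertex_degrees[OF finite_E that(1,2)]) (use that(3) E_cases in blast)+
    \<comment> \<open>\<open>X 2\<close> is not in \<open>?U2\<close>, so agreement off
      \<open>X 2\<close> fixes the total degree; the sums over \<open>?U1\<close> then fix the
      degree at \<open>X 2\<close>.\<close>
    have "sum ?a ?U2 = sum ?b ?U2"
    proof (intro sum.cong agree refl)
      fix v assume "v \<in> ?U2"
      then show "v \<in> V - {X 2}" using X2_V(3) Un by blast
    qed
    then have "monomial_degree a = monomial_degree b"
      using sums[OF fin(2) ab(1) conjunct2[OF split]] sums[OF fin(2) ab(2) conjunct2[OF split]] by (simp only:)
    then have "sum ?a ?U1 = sum ?b ?U1"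
      using sums[OF fin(1) ab(1) conjunct1[OF split]] sums[OF fin(1) ab(2) conjunct1[OF split]] by (simp only:)
    moreover have "sum ?a (?U1 - {X 2}) = sum ?b (?U1 - {X 2})"
    proof (intro sum.cong agree refl)
      fix v assume "v \<in> ?U1 - {X 2}"
      then show "v \<in> V - {X 2}" using Un by blast
    qed
    ultimately have "?a (X 2) = ?b (X 2)"
      using sum.remove[OF fin(1) X2_V(2), of ?a] sum.remove[OF fin(1) X2_V(2), of ?b] by simp
    show "vertex_degrees a = vertex_degrees b"
    proof (rule poly_mapping_eqI)
      fix v
      show "?a v = ?b v"
      proof (cases "v \<in> V")
        case True
        then show ?thesis using agree[of v] \<open>?a (X 2) = ?b (X 2)\<close> by (cases "v = X 2") auto
      next
        case False
        then show ?thesis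
          using vertex_degrees_in_V[OF ab(1)] vertex_degrees_in_V[OF ab(2)]
          by (metis in_keys_iff subset_iff)
      qed
    qed
  qed (use \<open>finite V\<close> in simp)
  also have "card (V - {X 2}) = d + 2 * k"
    using X2_V(1) \<open>finite V\<close> card_V by simp
  finally show "krull_dim A \<le> enat (d + 2 * k)" .
  \<comment> \<open>First the \<open>Y j\<close> are deleted, then the path vertices from
    \<open>X 1\<close> onwards, until only \<open>X 2\<close> is left. The terms
    \<open>min i d\<close> and the truncated \<open>i - d\<close> switch between the two
    phases.\<close>
  define W where "W i = Y ` {1..min i d} \<union> pv ` {..<i - d}" for i
  show "enat (d + 2 * k) \<le> krull_dim A"
  proof (rule krull_dim_ge[OF toric_graph_axioms, where W = W])
    fix i assume i: "i < d + 2 * k"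
    show "W i \<subseteq> W (Suc i)" unfolding W_def by auto
    show "\<exists>e\<in>E. e \<inter> W i = {} \<and> e \<inter> W (Suc i) \<noteq> {}"
    proof (cases "i < d")
      case True
      show ?thesis
      proof (intro bexI[of _ "{X 1, Y (Suc i)}"] conjI)
        show "{X 1, Y (Suc i)} \<in> E" unfolding E_eq using True by blast
      qed (use True in \<open>auto simp: W_def\<close>)
    next
      case False
      define j where "j = i - d"
      have j: "i = d + j" "j < 2 * k" using i False by (auto simp: j_def)
      show ?thesis
      proof (intro bexI[of _ "pe j"] conjI)
        show "pe j \<in> E" unfolding E_eq using j by blast
        show "pe j \<inter> W i = {}" using j by (auto simp: W_def pv_inj pv_neq_Y)
        show "pe j \<inter> W (Suc i) \<noteq> {}" using j by (auto simp: W_def)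
      qed
    qed
  qed
qed

text \<open>The Krull dimension fixes the exponent of \<open>1 - fps_X\<close>, so uniqueness
  reduces to the injectivity of \<open>fps_of_poly\<close>.\<close>

lemma h_polynomial_A: "h_polynomial A = h_poly k d"
  unfolding h_polynomial_def
proof (rule the_equality)
  show "\<exists>\<delta>. krull_dim A = enat \<delta> \<and> fps_of_poly (h_poly k d) = hilbert_series A * (1 - fps_X) ^ \<delta>"
    using krull_dim_A hilbert_series_eq by metis
  fix h assume "\<exists>\<delta>. krull_dim A = enat \<delta> \<and> fps_of_poly h = hilbert_series A * (1 - fps_X) ^ \<delta>"
  then have "fps_of_poly h = fps_of_poly (h_poly k d)"
    using krull_dim_A hilbert_series_eq by auto
  then show "h = h_poly k d" by simp
qed

end

theorem corollary6p25:
  fixes d r :: nat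
    and A :: "(vertex set, 'k::{alg_closed_field, field_char_0}) mpoly set graded_algebra"
  assumes "d \<ge> 1" and "r \<ge> 3"
    and "A = toric_ring (G_vertices r d) (G_edges r d)"
  shows "a_invariant A = 1 - int d - int r \<and>
    multiplicity_e A = int d * int r - (int d - 1)"
proof -
  obtain k where r: "r = Suc k" using assms(2) by (cases r) auto
  interpret G_toric k d A
    using assms by unfold_locales (auto simp: r)
  have "Polynomial.degree (h_poly k d) = k"
    using degree_h_poly assms r by simp
  \<comment> \<open>Degree minus dimension is \<open>k - (d + 2 * k)\<close> with
    \<open>k = r - 1\<close>.\<close>
  then have "a_invariant A = 1 - int d - int r"
    using r by (simp add: a_invariant_def h_polynomial_A krull_dim_A)
  moreover have "multiplicity_e A = int d * int r - (int d - 1)"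
    using r by (simp add: multiplicity_e_def h_polynomial_A poly_h_poly_1 algebra_simps)
  ultimately show ?thesis ..
qed

end
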